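(* Let $K$ be a quadratic field with discriminant $\Delta_K$, let $d=|\Delta_K|$, and let $\chi$ be the Dirichlet character attached to $K/\mathbb{Q}$. For $\mathrm{Re}(s)>1$ let $$p_1(s)=\prod_{\chi(p)=1}(1-p^{-s})^{-1},\qquad p_2(s)=\prod_{\chi(p)=-1}(1-p^{-s})^{-1}.$$ The functions $p_1$ and $p_2$ satisfy the functional equations $$\frac{p_i(2s)}{p_i(s)^2}=q_i(s),\qquad \lim_{\mathrm{Re}(s)\to+\infty}p_i(s)=1,\qquad\text{for } i=1,2,$$ where $$q_1(s)=\frac{\zeta(2s)}{\zeta(s)L(s,\chi)}\prod_{p\mid d}(1+p^{-s}),\qquad q_2(s)=\frac{L(s,\chi)}{\zeta(s)}\prod_{p\mid d}(1-p^{-s})^{-1}.$$ Furthermore, these functional equations have a unique solution, so they completely determine the functions $p_1$ and $p_2$.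
   Context: The functional equations are considered on the half-plane $\mathrm{Re}(s)>1$, and a solution means a complex-valued function on that half-plane satisfying both the equation and the limit condition. The Dirichlet character attached to the quadratic field $K$ is the primitive quadratic character modulo $d=|\Delta_K|$ given by the Kronecker symbol $\chi(n)=\left(\frac{\Delta_K}{n}\right)$; for a prime $p$, $\chi(p)=1,-1,0$ according as $p$ splits, is inert, or ramifies in $K$. $\zeta$ is the Riemann zeta function and $L(s,\chi)$ is the Dirichlet $L$-function of $\chi$. All products are over prime numbers $p$ satisfying the indicated condition. The notation $\lim_{\mathrm{Re}(s)\to+\infty}f(s)=c$ means: for every $\varepsilon>0$ there is $\sigma>0$ such that $|f(s)-c|<\varepsilon$ for all $s$ with $\mathrm{Re}(s)\ge\sigma$.
   Formalization: Uniqueness is proved among continuous functions on Re(s)>1 (p_1 and p_2 are shown to be continuous); among arbitrary functions it fails, since changing the sign of p_i at s=3/2 gives another solution. *)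

theory Defs
  imports "HOL-Analysis.Analysis" "HOL-Number_Theory.Number_Theory"
begin

section \<open>Quadratic fields and their discriminants\<close>

text \<open>Quadratic fields are taken as subfields of the complex numbers of dimension 2 over the
  rationals; every abstract quadratic field embeds there.\<close>

definition quadratic_field :: "complex set \<Rightarrow> bool" where
  "quadratic_field K \<longleftrightarrow>
     1 \<in> K \<and> (\<forall>x\<in>K. \<forall>y\<in>K. x - y \<in> K \<and> x * y \<in> K) \<and> (\<forall>x\<in>K. inverse x \<in> K) \<and>
     vector_space.dim (\<lambda>(r::rat) (x::complex). of_rat r * x) K = 2"

definition ring_of_integers :: "complex set \<Rightarrow> complex set" where
  "ring_of_integers K = {x \<in> K. algebraic_int x}"

text \<open>The field embeddings of K into the complex numbers. Extensionality (being undefined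
  outside K) makes each embedding occur only once as a HOL function.\<close>

definition field_embeddings :: "complex set \<Rightarrow> (complex \<Rightarrow> complex) set" where
  "field_embeddings K =
     {\<sigma> \<in> K \<rightarrow>\<^sub>E UNIV. \<sigma> 1 = 1 \<and>
        (\<forall>x\<in>K. \<forall>y\<in>K. \<sigma> (x + y) = \<sigma> x + \<sigma> y \<and> \<sigma> (x * y) = \<sigma> x * \<sigma> y)}"

definition field_trace :: "complex set \<Rightarrow> complex \<Rightarrow> complex" where
  "field_trace K x = (\<Sum>\<sigma>\<in>field_embeddings K. \<sigma> x)"

text \<open>Unique integer coordinates with respect to a and b for all elements of the ring of
  integers.\<close>

definition integral_basis :: "complex set \<Rightarrow> complex \<Rightarrow> complex \<Rightarrow> bool" where
  "integral_basis K a b \<longleftrightarrow>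
     bij_betw (\<lambda>(m::int, n::int). of_int m * a + of_int n * b) UNIV (ring_of_integers K)"

text \<open>The discriminant is the determinant of the trace form on an integral basis; it does not
  depend on the basis.\<close>

definition field_discriminant :: "complex set \<Rightarrow> int" where
  "field_discriminant K = (SOME D. \<exists>a b. integral_basis K a b \<and>
     of_int D = field_trace K (a * a) * field_trace K (b * b)
                - field_trace K (a * b) * field_trace K (b * a))"


section \<open>The quadratic character\<close>

text \<open>The Kronecker symbol with non-negative lower argument.\<close>

definition kronecker_prime :: "int \<Rightarrow> nat \<Rightarrow> int" where
  "kronecker_prime a p =
     (if p = 2 then (if even a then 0 else if a mod 8 = 1 \<or> a mod 8 = 7 then 1 else -1)
      else Legendre a (int p))"

definition kronecker :: "int \<Rightarrow> nat \<Rightarrow> int" where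
  "kronecker a n =
     (if n = 0 then (if \<bar>a\<bar> = 1 then 1 else 0)
      else (\<Prod>p\<in>prime_factors n. kronecker_prime a p ^ multiplicity p n))"

definition quadratic_character :: "complex set \<Rightarrow> nat \<Rightarrow> int" where
  "quadratic_character K n = kronecker (field_discriminant K) n"


section \<open>Dirichlet series and Euler products\<close>

text \<open>Both series are used only in the half-plane of absolute convergence.\<close>

definition zeta :: "complex \<Rightarrow> complex" where
  "zeta s = (\<Sum>n. of_nat (Suc n) powr (-s))"

definition L_function :: "(nat \<Rightarrow> int) \<Rightarrow> complex \<Rightarrow> complex" where
  "L_function c s = (\<Sum>n. of_int (c (Suc n)) * of_nat (Suc n) powr (-s))"

text \<open>Product over the primes satisfying P, in increasing order; the set of these primes
  may be infinite.\<close>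

definition prime_prod :: "(nat \<Rightarrow> bool) \<Rightarrow> (nat \<Rightarrow> complex) \<Rightarrow> complex" where
  "prime_prod P g = (\<Prod>n. if prime n \<and> P n then g n else 1)"

definition p1 :: "complex set \<Rightarrow> complex \<Rightarrow> complex" where
  "p1 K s = prime_prod (\<lambda>p. quadratic_character K p = 1) (\<lambda>p. inverse (1 - of_nat p powr (-s)))"

definition p2 :: "complex set \<Rightarrow> complex \<Rightarrow> complex" where
  "p2 K s = prime_prod (\<lambda>p. quadratic_character K p = -1) (\<lambda>p. inverse (1 - of_nat p powr (-s)))"

definition q1 :: "complex set \<Rightarrow> complex \<Rightarrow> complex" where
  "q1 K s = zeta (2 * s) / (zeta s * L_function (quadratic_character K) s) *
     (\<Prod>p | prime p \<and> p dvd nat \<bar>field_discriminant K\<bar>. 1 + of_nat p powr (-s))"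

definition q2 :: "complex set \<Rightarrow> complex \<Rightarrow> complex" where
  "q2 K s = L_function (quadratic_character K) s / zeta s *
     (\<Prod>p | prime p \<and> p dvd nat \<bar>field_discriminant K\<bar>. inverse (1 - of_nat p powr (-s)))"


section \<open>The functional equation\<close>

definition half_plane :: "complex set" where
  "half_plane = {s. Re s > 1}"

definition Re_limit :: "(complex \<Rightarrow> complex) \<Rightarrow> complex \<Rightarrow> bool" where
  "Re_limit f c \<longleftrightarrow> (\<forall>\<epsilon>>0. \<exists>\<sigma>>0. \<forall>s. Re s \<ge> \<sigma> \<longrightarrow> norm (f s - c) < \<epsilon>)"

text \<open>Values of f outside the half-plane are irrelevant: the bound in the limit can always be
  enlarged. Where q does not vanish, the equation forces f to be nonzero, since division by
  zero yields zero.\<close>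

definition satisfies_equation :: "(complex \<Rightarrow> complex) \<Rightarrow> (complex \<Rightarrow> complex) \<Rightarrow> bool" where
  "satisfies_equation q f \<longleftrightarrow>
     (\<forall>s\<in>half_plane. f (2 * s) / (f s)\<^sup>2 = q s) \<and> Re_limit f 1"

text \<open>Uniqueness fails among arbitrary functions: the equation determines the value at a point
  s with real part in (1,2] only up to sign, because no such s is the double of a point of the
  half-plane. Hence solutions are compared within the continuous functions.\<close>

lemma not_unique_without_continuity:
  assumes "satisfies_equation q p" and "q (3/2) \<noteq> 0"
  shows "\<exists>f. satisfies_equation q f \<and> f (3/2) \<noteq> p (3/2)"
proof -
  define f where "f = p(3/2 := - p (3/2))"
  have ne: "2 * s \<noteq> 3/2" if "s \<in> half_plane" for s
    using that by (auto simp: half_plane_def complex_eq_iff)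
  have eq: "p (2 * s) / (p s)\<^sup>2 = q s" if "s \<in> half_plane" for s
    using assms(1) that by (auto simp: satisfies_equation_def)
  have "p (3/2) \<noteq> 0"
    using eq[of "3/2"] assms(2) by (auto simp: half_plane_def)
  hence "f (3/2) \<noteq> p (3/2)"
    by (simp add: f_def)
  moreover have "f (2 * s) / (f s)\<^sup>2 = q s" if "s \<in> half_plane" for s
  proof -
    have "f (2 * s) = p (2 * s)"
      unfolding f_def using ne[OF that] by (rule fun_upd_other)
    moreover have "(f s)\<^sup>2 = (p s)\<^sup>2"
    proof (cases "s = 3/2")
      case True
      show ?thesis unfolding True f_def by simp
    next
      case False
      show ?thesis unfolding f_def by (subst fun_upd_other) (rule False, rule refl)
    qed
    ultimately show ?thesis
      using eq[OF that] by simp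
  qed
  moreover have "Re_limit f 1"
    unfolding Re_limit_def
  proof (intro allI impI)
    fix \<epsilon> :: real
    assume "\<epsilon> > 0"
    then obtain \<sigma> where \<sigma>: "\<sigma> > 0" "\<And>s. Re s \<ge> \<sigma> \<Longrightarrow> norm (p s - 1) < \<epsilon>"
      using assms(1) unfolding satisfies_equation_def Re_limit_def by blast
    have "norm (f s - 1) < \<epsilon>" if "Re s \<ge> max \<sigma> 2" for s
    proof -
      have "s \<noteq> 3/2"
        using that by (auto simp: complex_eq_iff)
      thus ?thesis
        using that \<sigma>(2)[of s] by (simp add: f_def)
    qed
    thus "\<exists>\<sigma>>0. \<forall>s. Re s \<ge> \<sigma> \<longrightarrow> norm (f s - 1) < \<epsilon>"
      using \<sigma>(1) by (intro exI[of _ "max \<sigma> 2"]) auto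
  qed
  ultimately show ?thesis
    unfolding satisfies_equation_def by blast
qed

end

theory Submission
  imports Defs "HOL-Real_Asymp.Real_Asymp"
begin

text \<open>The functions p1, p2 and zeta are, like L, of the form L_function c for a completely
  multiplicative c with values of modulus at most 1: for the products over primes, c is the
  indicator of the numbers all of whose prime factors are admissible. For such c, sieving the
  series by the primes p < N gives L_function c s times the product of the 1 - c(p) p^-s, which
  tends to 1; so L_function c is nonzero and equals its Euler product. The functional equations
  are then identities between the local factors for chi(p) = 1, -1, 0.

  The quotient r of two continuous solutions satisfies r(2s) = r(s)^2 and tends to 1. Hence r = 1
  far to the right, so r(s)^(2^n) = 1 on larger and larger half-planes; a continuous function with
  finitely many values on a connected set is constant.

  The quadratic field enters only through the fact that its discriminant is nonzero, without which
  the product over the prime divisors of d would have the junk value 1. Since the discriminant is chosen by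
  SOME, this also needs an integral basis. For K = Q + Qw with w^2 = m, one such basis is 1 and
  x0 + y0 w, where y0 > 0 is minimal.\<close>

section \<open>Euler products\<close>

text \<open>A new prime \<open>p\<close> removes from the surviving numbers exactly the multiples
  \<open>p * m\<close> with \<open>m\<close> itself surviving. By multiplicativity these carry the
  share \<open>f p\<close> of the current sum, so each prime contributes one factor
  \<open>1 - f p\<close>.\<close>

lemma infsum_coprime_primes:
  fixes f :: "nat \<Rightarrow> complex"
  assumes summable: "summable (\<lambda>n. norm (f n))"
    and mult: "\<And>m n. f (m * n) = f m * f n"
    and "finite P" "\<And>p. p \<in> P \<Longrightarrow> prime p"
  shows "infsum f {n. \<forall>p\<in>P. \<not> p dvd n} = (\<Prod>p\<in>P. 1 - f p) * infsum f UNIV"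
  using assms(3,4)
proof (induction P rule: finite_induct)
  case empty
  thus ?case by simp
next
  case (insert p P)
  let ?A = "\<lambda>P. {n. \<forall>p\<in>P. \<not> p dvd n}"
  have abs: "(\<lambda>n. norm (f n)) summable_on A" for A
    using summable_on_subset_banach[of "\<lambda>n. norm (f n)" UNIV A] summable
    by (simp add: summable_on_UNIV_nonneg_real_iff)
  hence sm: "f summable_on A" for A
    using abs_summable_summable by blast
  have p: "prime p" and P: "\<And>q. q \<in> P \<Longrightarrow> prime q"
    using insert.prems by auto
  have split: "?A P = ?A (insert p P) \<union> (\<lambda>m. p * m) ` ?A P"
  proof (rule equalityI; rule subsetI)
    fix n assume n: "n \<in> ?A P"
    show "n \<in> ?A (insert p P) \<union> (\<lambda>m. p * m) ` ?A P"
    proof (cases "p dvd n")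
      case True
      then obtain m where m: "n = p * m" by blast
      with n have "m \<in> ?A P" by auto
      with m show ?thesis by blast
    qed (use n in auto)
  next
    fix n assume n: "n \<in> ?A (insert p P) \<union> (\<lambda>m. p * m) ` ?A P"
    have "\<not> q dvd p * m" if "q \<in> P" "m \<in> ?A P" for q m
      using that P[of q] p insert.hyps(2) by (auto simp: prime_dvd_mult_iff dest: primes_dvd_imp_eq)
    with n show "n \<in> ?A P" by auto
  qed
  have "infsum f ((\<lambda>m. p * m) ` ?A P) = infsum (\<lambda>m. f p * f m) (?A P)"
    using p by (subst infsum_reindex) (auto simp: inj_on_def o_def mult)
  also have "\<dots> = f p * infsum f (?A P)"
    by (rule infsum_cmult_right')
  finally have "infsum f (?A P) = infsum f (?A (insert p P)) + f p * infsum f (?A P)"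
    by (subst split, subst infsum_Un_disjoint) (auto intro: sm)
  hence "infsum f (?A (insert p P)) = (1 - f p) * infsum f (?A P)"
    by (simp add: algebra_simps)
  with insert show ?case by simp
qed

text \<open>Apart from 0, where \<open>f\<close> vanishes, the sieve by the primes below
  \<open>N\<close> leaves 1 and numbers that are at least \<open>N\<close>. So the sieved sum
  differs from 1 by at most a tail of the norm series, and a vanishing \<open>suminf f\<close> would
  make 0 converge to 1.\<close>

lemma euler_product:
  fixes f :: "nat \<Rightarrow> complex"
  assumes summable: "summable (\<lambda>n. norm (f n))"
    and mult: "\<And>m n. f (m * n) = f m * f n"
    and f0: "f 0 = 0" and f1: "f 1 = 1"
  shows "suminf f \<noteq> 0"
    and "(\<lambda>N. \<Prod>p | prime p \<and> p < N. 1 - f p) \<longlonglongrightarrow> inverse (suminf f)"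
proof -
  define g where "g = (\<lambda>n. norm (f n))"
  define A where "A = (\<lambda>N. {n::nat. \<forall>p\<in>{p. prime p \<and> p < N}. \<not> p dvd n})"
  have gsm: "g summable_on X" for X
    using summable_on_subset_banach[of g UNIV X] summable
    by (simp add: summable_on_UNIV_nonneg_real_iff g_def)
  hence abs: "(\<lambda>n. norm (f n)) summable_on X" for X by (simp add: g_def)
  hence fsm: "f summable_on X" for X using abs_summable_summable by blast
  have inf_f: "infsum f UNIV = suminf f"
    using norm_summable_imp_has_sum[OF summable summable_sums[OF summable_norm_cancel[OF summable]]]
    by (rule infsumI)
  have inf_g: "infsum g UNIV = suminf g"
    using norm_summable_imp_has_sum[of g] summable by (auto simp: g_def intro!: infsumI)
  have prod: "infsum f (A N) = (\<Prod>p | prime p \<and> p < N. 1 - f p) * suminf f" for N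
    unfolding A_def by (subst infsum_coprime_primes[OF summable mult]) (auto simp: inf_f)
  have bound: "norm (infsum f (A N) - 1) \<le> suminf g - sum g {..<N}" if "N \<ge> 2" for N
  proof -
    \<comment> \<open>For \<open>N = 2\<close> no prime has been sieved and 0 is still present. It
      is set aside because it has prime divisors without being large; \<open>f 0 = 0\<close> makes
      this free.\<close>
    have sub: "A N - {0, 1} \<subseteq> {N..}"
    proof
      fix n assume n: "n \<in> A N - {0, 1}"
      then obtain p where p: "prime p" "p dvd n" using prime_factor_nat[of n] by auto
      with n have "p \<ge> N" by (force simp: A_def)
      moreover have "p \<le> n" using p n by (auto intro: dvd_imp_le)
      ultimately show "n \<in> {N..}" by simp
    qed
    have "1 \<in> A N" by (auto simp: A_def)
    hence "infsum f (A N) = infsum f ({1} \<union> (A N - {1}))" by (simp add: insert_absorb)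
    also have "\<dots> = 1 + infsum f (A N - {1})"
      by (subst infsum_Un_disjoint) (use f1 in \<open>auto intro: fsm\<close>)
    also have "infsum f (A N - {1}) = infsum f (A N - {0, 1})"
      by (rule infsum_cong_neutral) (auto simp: f0)
    finally have "norm (infsum f (A N) - 1) = norm (infsum f (A N - {0, 1}))" by simp
    also have "\<dots> \<le> infsum g (A N - {0, 1})"
      unfolding g_def by (rule norm_infsum_bound[OF abs])
    also have "\<dots> \<le> infsum g {N..}"
      using sub by (intro infsum_mono2 gsm) (auto simp: g_def)
    also have "\<dots> = suminf g - sum g {..<N}"
    proof -
      have "infsum g UNIV = infsum g ({..<N} \<union> {N..})" by (rule arg_cong[of _ _ "infsum g"]) auto
      also have "\<dots> = sum g {..<N} + infsum g {N..}"
        by (subst infsum_Un_disjoint) (auto intro: gsm)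
      finally show ?thesis by (simp add: inf_g)
    qed
    finally show ?thesis .
  qed
  have "(\<lambda>N. suminf g - sum g {..<N}) \<longlonglongrightarrow> suminf g - suminf g"
    using summable by (intro tendsto_diff tendsto_const summable_LIMSEQ) (simp add: g_def)
  hence "(\<lambda>N. infsum f (A N) - 1) \<longlonglongrightarrow> 0"
    using Lim_null_comparison[OF eventually_mono[OF eventually_ge_at_top[of 2] bound]] by simp
  hence lim: "(\<lambda>N. (\<Prod>p | prime p \<and> p < N. 1 - f p) * suminf f) \<longlonglongrightarrow> 1"
    using Lim_null[of "\<lambda>N. infsum f (A N)" 1 sequentially] by (simp add: prod)
  show nz: "suminf f \<noteq> 0"
  proof
    assume "suminf f = 0"
    with lim show False by (simp add: LIMSEQ_const_iff)
  qed
  have "(\<lambda>N. (\<Prod>p | prime p \<and> p < N. 1 - f p) * suminf f * inverse (suminf f)) \<longlonglongrightarrow> 1 * inverse (suminf f)"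
    by (intro tendsto_mult lim tendsto_const)
  thus "(\<lambda>N. \<Prod>p | prime p \<and> p < N. 1 - f p) \<longlonglongrightarrow> inverse (suminf f)"
    using nz by (simp add: mult.assoc)
qed

section \<open>Dirichlet series with completely multiplicative coefficients\<close>

text \<open>Multiplicativity is confined to positive arguments because the value at 0 may violate
  it: \<open>prime_support_char\<close> is 1 there, as 0 has an empty set of prime factors. The
  series starts at 1 and never sees \<open>c 0\<close>.\<close>

locale real_character =
  fixes c :: "nat \<Rightarrow> int"
  assumes one: "c 1 = 1"
    and mult: "m > 0 \<Longrightarrow> n > 0 \<Longrightarrow> c (m * n) = c m * c n"
    and bound: "n > 0 \<Longrightarrow> \<bar>c n\<bar> \<le> 1"
begin

lemma norm_term_le: "norm (of_int (c (Suc n)) * of_nat (Suc n) powr (- s)) \<le> real (Suc n) powr (- Re s)"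
proof -
  have "norm (of_int (c (Suc n)) * of_nat (Suc n) powr (- s) :: complex)
      = real_of_int \<bar>c (Suc n)\<bar> * real (Suc n) powr (- Re s)"
    by (simp add: norm_mult norm_powr_real_powr' norm_powr_real_powr del: of_nat_Suc)
  also have "real_of_int \<bar>c (Suc n)\<bar> \<le> 1"
    using bound[of "Suc n"] by linarith
  hence "real_of_int \<bar>c (Suc n)\<bar> * real (Suc n) powr (- Re s) \<le> 1 * real (Suc n) powr (- Re s)"
    by (intro mult_right_mono) auto
  finally show ?thesis by simp
qed

lemma summable_Suc_powr: "a > 1 \<Longrightarrow> summable (\<lambda>n. real (Suc n) powr (- a))"
  using summable_real_powr_iff[of "-a"] summable_Suc_iff[of "\<lambda>n. real n powr (-a)"] by simp

lemma summable_norm_term: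
  assumes "Re s > 1"
  shows "summable (\<lambda>n. norm (of_int (c (Suc n)) * of_nat (Suc n) powr (- s) :: complex))"
  by (rule summable_comparison_test'[OF summable_Suc_powr[OF assms], of 0])
     (use norm_term_le in auto)

lemma
  assumes s: "Re s > 1"
  shows L_function_nonzero: "L_function c s \<noteq> 0"
    and L_function_euler:
      "(\<lambda>N. \<Prod>p | prime p \<and> p < N. 1 - of_int (c p) * of_nat p powr (- s))
         \<longlonglongrightarrow> inverse (L_function c s)"
proof -
  \<comment> \<open>Index 0 costs nothing since \<open>0 powr (-s) = 0\<close>, and it makes
    \<open>f\<close> multiplicative on all naturals, as \<open>euler_product\<close>
    requires.\<close>
  define f where "f = (\<lambda>n. of_int (c n) * of_nat n powr (- s) :: complex)"
  have sm: "summable (\<lambda>n. norm (f n))"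
    using summable_norm_term[OF s] summable_Suc_iff[of "\<lambda>n. norm (f n)"] by (simp add: f_def)
  have f0: "f 0 = 0" and f1: "f 1 = 1" using one by (auto simp: f_def)
  have fm: "f (m * n) = f m * f n" for m n
    by (cases "m = 0 \<or> n = 0") (auto simp: f_def mult powr_times_real)
  have "suminf f = L_function c s"
    using suminf_split_head[OF summable_norm_cancel[OF sm]] f0 by (simp add: L_function_def f_def)
  thus "L_function c s \<noteq> 0" and "(\<lambda>N. \<Prod>p | prime p \<and> p < N. 1 - of_int (c p) * of_nat p powr (- s))
         \<longlonglongrightarrow> inverse (L_function c s)"
    using euler_product[OF sm fm f0 f1] by (simp_all add: f_def)
qed

text \<open>Around a point one picks \<open>1 < a < Re s\<close>. On the half-plane to the right of
  \<open>a\<close> the series is dominated by the sum of \<open>n powr (-a)\<close>, so the partial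
  sums converge uniformly there.\<close>

lemma continuous_on_L_function: "continuous_on half_plane (L_function c)"
proof -
  have "isCont (L_function c) s" if s: "Re s > 1" for s
  proof -
    obtain a where a: "1 < a" "a < Re s" using s dense by blast
    have lim: "uniform_limit {s. Re s > a}
        (\<lambda>N s. \<Sum>n<N. of_int (c (Suc n)) * of_nat (Suc n) powr (- s)) (L_function c) sequentially"
      unfolding L_function_def
    proof (rule Weierstrass_m_test[OF _ summable_Suc_powr[OF a(1)]])
      fix n s assume s: "s \<in> {s. Re s > a}"
      note norm_term_le[of n s]
      also have "real (Suc n) powr (- Re s) \<le> real (Suc n) powr (- a)"
        using s by (intro powr_mono) auto
      finally show "norm (of_int (c (Suc n)) * of_nat (Suc n) powr (- s)) \<le> real (Suc n) powr (- a)" .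
    qed
    have "continuous_on {s. Re s > a} (L_function c)"
      by (rule uniform_limit_theorem[OF _ lim])
         (auto intro!: continuous_intros always_eventually simp del: of_nat_Suc)
    thus ?thesis
      using a(2) continuous_on_eq_continuous_at[OF open_halfspace_Re_gt[of a]] by auto
  qed
  thus ?thesis
    by (intro continuous_at_imp_continuous_on) (auto simp: half_plane_def)
qed

text \<open>The first term is the limit 1. For n \<ge> 2 and Re s \<ge> 2, the bound
  \<open>n powr (- Re s)\<close> splits into \<open>n powr (2 - Re s)\<close>, at most
  \<open>2 powr (2 - Re s)\<close>, and \<open>n powr (-2)\<close>: a decaying factor times a fixed
  convergent series.\<close>

lemma Re_limit_L_function: "Re_limit (L_function c) 1"
proof -
  define M where "M = (\<Sum>n. real (n + 2) powr (- 2))"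
  have sm2: "summable (\<lambda>n. real (n + 2) powr (- 2))"
    using summable_real_powr_iff[of "-2"] summable_iff_shift[of "\<lambda>n. real n powr (-2)" 2] by simp
  have M0: "M \<ge> 0" unfolding M_def by (intro suminf_nonneg sm2) auto
  have est: "norm (L_function c s - 1) \<le> 2 powr (2 - Re s) * M" if s: "Re s \<ge> 2" for s
  proof -
    define t where "t = (\<lambda>n. of_int (c (Suc n)) * of_nat (Suc n) powr (- s) :: complex)"
    have smt: "summable (\<lambda>n. norm (t n))"
      using summable_norm_term[of s] s by (simp add: t_def)
    have "L_function c s - 1 = (\<Sum>n. t (Suc n))"
      using suminf_split_head[OF summable_norm_cancel[OF smt]] one by (simp add: L_function_def t_def)
    also have "norm \<dots> \<le> (\<Sum>n. norm (t (Suc n)))"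
      using smt by (intro summable_norm) (subst summable_Suc_iff)
    also have "\<dots> \<le> (\<Sum>n. 2 powr (2 - Re s) * real (n + 2) powr (- 2))"
    proof (intro suminf_le summable_mult sm2)
      fix n
      have "norm (t (Suc n)) \<le> real (n + 2) powr (- Re s)"
        using norm_term_le[of "Suc n" s] by (simp add: t_def add.commute)
      also have "\<dots> = real (n + 2) powr (2 - Re s) * real (n + 2) powr (- 2)"
        by (simp flip: powr_add)
      also have "\<dots> \<le> 2 powr (2 - Re s) * real (n + 2) powr (- 2)"
        using s by (intro mult_right_mono powr_mono2') auto
      finally show "norm (t (Suc n)) \<le> 2 powr (2 - Re s) * real (n + 2) powr (- 2)" .
    qed (use smt in \<open>subst summable_Suc_iff\<close>)
    also have "\<dots> = 2 powr (2 - Re s) * M"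
      unfolding M_def by (rule suminf_mult[OF sm2])
    finally show ?thesis .
  qed
  have lim: "((\<lambda>x::real. 2 powr (2 - x) * M) \<longlongrightarrow> 0) at_top"
  proof -
    have "((\<lambda>x::real. 2 powr (2 - x)) \<longlongrightarrow> 0) at_top" by real_asymp
    thus ?thesis using tendsto_mult_left_zero by blast
  qed
  show ?thesis
    unfolding Re_limit_def
  proof (intro allI impI)
    fix e :: real assume "e > 0"
    with lim have "\<forall>\<^sub>F x in at_top. 2 powr (2 - x) * M < e"
      by (rule order_tendstoD(2))
    then obtain b where b: "\<And>x. x \<ge> b \<Longrightarrow> 2 powr (2 - x) * M < e"
      by (auto simp: eventually_at_top_linorder)
    have "norm (L_function c s - 1) < e" if "Re s \<ge> max b 2" for s
      using est[of s] b[of "Re s"] that by simp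
    thus "\<exists>\<sigma>>0. \<forall>s. Re s \<ge> \<sigma> \<longrightarrow> norm (L_function c s - 1) < e"
      by (intro exI[of _ "max b 2"]) auto
  qed
qed

end

section \<open>Uniqueness\<close>

text \<open>Repeated squaring moves any point of the unit ball around 1 other than 1 itself away from 1.\<close>

lemma squares_near_1_imp_eq_1:
  fixes w :: complex
  assumes "\<And>n. norm (w ^ (2 ^ n) - 1) < 1/2"
  shows "w = 1"
proof (rule ccontr)
  assume "w \<noteq> 1"
  \<comment> \<open>With \<open>u = w ^ (2 ^ n) - 1\<close>, the next difference is
    \<open>u * (u + 2)\<close>. Since \<open>norm u < 1/2\<close>, the second factor has modulus at
    least 3/2, so the distance to 1 grows geometrically.\<close>
  have "(3/2) ^ n * norm (w - 1) \<le> norm (w ^ (2 ^ n) - 1)" for n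
  proof (induction n)
    case (Suc n)
    let ?u = "w ^ (2 ^ n) - 1"
    have "norm (2::complex) - norm (- ?u) \<le> norm (2 - (- ?u))" by (rule norm_triangle_ineq2)
    hence "3/2 \<le> norm (?u + 2)" using assms[of n] by (simp add: add.commute norm_minus_commute)
    hence "norm ?u * (3/2) \<le> norm ?u * norm (?u + 2)" by (intro mult_left_mono) auto
    also have "\<dots> = norm (w ^ (2 ^ Suc n) - 1)"
      by (simp flip: norm_mult add: power_mult algebra_simps power2_eq_square mult_2 power_add)
    finally show ?case using Suc by simp
  qed simp
  moreover obtain n where "(1/2) / norm (w - 1) < (3/2) ^ n"
    using real_arch_pow[of "3/2"] by auto
  hence "1/2 < (3/2) ^ n * norm (w - 1)"
    using \<open>w \<noteq> 1\<close> by (subst (asm) pos_divide_less_eq) auto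
  ultimately show False
    using assms[of n] by (meson less_asym less_le_trans)
qed

lemma satisfies_equation_unique:
  assumes g: "satisfies_equation q g" "continuous_on half_plane g" "\<And>s. s \<in> half_plane \<Longrightarrow> g s \<noteq> 0"
    and f: "satisfies_equation q f" "continuous_on half_plane f"
    and s: "s \<in> half_plane"
  shows "f s = g s"
proof -
  have dbl: "2 * s \<in> half_plane" if "s \<in> half_plane" for s
    using that by (simp add: half_plane_def)
  have q: "q s \<noteq> 0" if "s \<in> half_plane" for s
    using g(1) g(3)[OF that] g(3)[OF dbl[OF that]] that by (auto simp: satisfies_equation_def)
  \<comment> \<open>The equation alone forces this: at a zero of \<open>f\<close> the left-hand side
    would be 0 by the convention on division, while \<open>q s\<close> is nonzero.\<close>
  have fnz: "f s \<noteq> 0" if "s \<in> half_plane" for s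
    using f(1) q[OF that] that by (auto simp: satisfies_equation_def)
  define r where "r = (\<lambda>s. f s / g s)"
  have r2: "r (2 * s) = r s ^ 2" if "s \<in> half_plane" for s
  proof -
    have "f (2 * s) / (f s)\<^sup>2 = g (2 * s) / (g s)\<^sup>2"
      using f(1) g(1) that by (auto simp: satisfies_equation_def)
    thus ?thesis
      using fnz[OF that] g(3)[OF that] g(3)[OF dbl[OF that]]
      by (simp add: r_def field_simps)
  qed
  have iter: "of_nat (2 ^ n) * s \<in> half_plane \<and> r (of_nat (2 ^ n) * s) = r s ^ (2 ^ n)"
    if "s \<in> half_plane" for s n
  proof (induction n)
    case (Suc n)
    hence "r (2 * (of_nat (2 ^ n) * s)) = (r s ^ (2 ^ n)) ^ 2"
      using r2[of "of_nat (2 ^ n) * s"] by metis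
    moreover have "2 * (of_nat (2 ^ n) * s) \<in> half_plane" using Suc dbl by blast
    ultimately show ?case by (simp add: mult.assoc power_mult mult.commute[of 2])
  qed (use that in auto)
  obtain \<sigma> where \<sigma>: "\<sigma> > 1" "\<And>s. Re s \<ge> \<sigma> \<Longrightarrow> norm (r s - 1) < 1/2"
  proof -
    obtain \<sigma>1 \<sigma>2 where 1: "\<And>s. Re s \<ge> \<sigma>1 \<Longrightarrow> norm (f s - 1) < 1/8"
      and 2: "\<And>s. Re s \<ge> \<sigma>2 \<Longrightarrow> norm (g s - 1) < 1/8"
      using f(1) g(1) unfolding satisfies_equation_def Re_limit_def
      by (metis zero_less_divide_1_iff zero_less_numeral)
    \<comment> \<open>Deviations below 1/8 give \<open>norm (f s - g s) \<le> 1/4\<close> and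
      \<open>norm (g s) > 3/4\<close>, which suffices. The threshold 2 keeps \<open>s\<close> in the
      half-plane, where \<open>g\<close> has no zeros.\<close>
    have "norm (r s - 1) < 1/2" if s: "Re s \<ge> max 2 (max \<sigma>1 \<sigma>2)" for s
    proof -
      have "g s \<noteq> 0" using g(3)[of s] s by (auto simp: half_plane_def)
      hence "norm (r s - 1) = norm ((f s - 1) - (g s - 1)) / norm (g s)"
        by (simp add: r_def field_simps flip: norm_divide)
      also have "norm ((f s - 1) - (g s - 1)) \<le> 1/4"
        using norm_triangle_ineq4[of "f s - 1" "g s - 1"] 1[of s] 2[of s] s by simp
      hence "norm ((f s - 1) - (g s - 1)) / norm (g s) \<le> (1/4) / norm (g s)"
        by (intro divide_right_mono) auto
      also have "norm (g s) > 3/4"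
        using norm_triangle_ineq2[of 1 "1 - g s"] 2[of s] s by (simp add: norm_minus_commute)
      hence "(1/4) / norm (g s) < 1/2"
        by (subst divide_less_eq) auto
      finally show ?thesis .
    qed
    thus ?thesis using that[of "max 2 (max \<sigma>1 \<sigma>2)"] by auto
  qed
  \<comment> \<open>Doubling only moves \<open>s\<close> further right, so every
    \<open>r s ^ (2 ^ n)\<close> is a value of \<open>r\<close> in the region where \<open>r\<close>
    is within 1/2 of 1.\<close>
  have r1: "r s = 1" if "Re s \<ge> \<sigma>" for s
  proof (rule squares_near_1_imp_eq_1)
    fix n
    have s: "s \<in> half_plane" using that \<sigma>(1) by (simp add: half_plane_def)
    have "1 * Re s \<le> 2 ^ n * Re s" using that \<sigma>(1) by (intro mult_right_mono) auto
    hence "Re (of_nat (2 ^ n) * s) \<ge> \<sigma>" using that by simp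
    thus "norm (r s ^ (2 ^ n) - 1) < 1/2" using \<sigma>(2) iter[OF s] by metis
  qed
  \<comment> \<open>One exponent serves the whole half-plane: since \<open>Re s > 1\<close>, the
    point \<open>2 ^ n * s\<close> lies beyond \<open>\<sigma>\<close> for every \<open>s\<close>.
    Hence all values of \<open>r\<close> are roots of unity of one fixed order, a finite
    set.\<close>
  obtain n where n: "\<sigma> < 2 ^ n" using real_arch_pow[of 2 \<sigma>] by auto
  have root: "r s ^ (2 ^ n) = 1" if s: "s \<in> half_plane" for s
  proof -
    have "2 ^ n * 1 \<le> 2 ^ n * Re s" using s by (intro mult_left_mono) (auto simp: half_plane_def)
    with n have "\<sigma> \<le> 2 ^ n * Re s" by linarith
    hence "Re (of_nat (2 ^ n) * s) \<ge> \<sigma>" by simp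
    thus ?thesis using r1 iter[OF s] by metis
  qed
  have "finite (r ` half_plane)"
    by (rule finite_subset[of _ "{z. z ^ (2 ^ n) = 1}"]) (use root in \<open>auto intro: finite_roots_unity\<close>)
  moreover have "continuous_on half_plane r"
    unfolding r_def using f(2) g(2,3) by (intro continuous_on_divide) auto
  moreover have "connected half_plane"
    unfolding half_plane_def by (intro convex_connected convex_halfspace_Re_gt)
  ultimately have "r constant_on half_plane" by (intro continuous_finite_range_constant)
  moreover have "of_real \<sigma> \<in> half_plane" using \<sigma>(1) by (simp add: half_plane_def)
  ultimately have "r s = r (of_real \<sigma>)" using s unfolding constant_on_def by metis
  also have "\<dots> = 1" by (rule r1) simp
  finally show ?thesis using g(3)[OF s] by (simp add: r_def)
qed

section \<open>The functional equations\<close>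

lemma kronecker_1: "kronecker a 1 = 1"
  by (simp add: kronecker_def)

lemma kronecker_prime: "prime p \<Longrightarrow> kronecker a p = kronecker_prime a p"
  by (simp add: kronecker_def prime_factorization_prime prime_gt_0_nat)

lemma kronecker_prime_cases: "kronecker_prime a p \<in> {-1, 0, 1}"
  by (auto simp: kronecker_prime_def Legendre_def)

lemma kronecker_prime_eq_0_iff:
  "prime p \<Longrightarrow> kronecker_prime a p = 0 \<longleftrightarrow> int p dvd a"
  by (auto simp: kronecker_prime_def Legendre_def cong_0_iff)

text \<open>All three symbols become products over the union of the two sets of prime factors, where
  a foreign prime has multiplicity 0 and contributes 1. Then multiplicities add.\<close>

lemma kronecker_mult:
  assumes "m > 0" "n > 0"
  shows "kronecker a (m * n) = kronecker a m * kronecker a n"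
proof -
  let ?P = "prime_factors m \<union> prime_factors n"
  have *: "kronecker a k = (\<Prod>p\<in>?P. kronecker_prime a p ^ multiplicity p k)"
    if "k > 0" "prime_factors k \<subseteq> ?P" for k
  proof -
    have "(\<Prod>p\<in>prime_factors k. kronecker_prime a p ^ multiplicity p k) =
        (\<Prod>p\<in>?P. kronecker_prime a p ^ multiplicity p k)"
    proof (intro prod.mono_neutral_left that ballI)
      fix p assume p: "p \<in> ?P - prime_factors k"
      hence "multiplicity p k = 0"
        using that(1) by (auto simp: in_prime_factors_iff not_dvd_imp_multiplicity_0)
      thus "kronecker_prime a p ^ multiplicity p k = 1" by simp
    qed auto
    thus ?thesis using that(1) by (simp add: kronecker_def)
  qed
  have "kronecker a (m * n) = (\<Prod>p\<in>?P. kronecker_prime a p ^ multiplicity p (m * n))"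
    using assms by (intro *) (auto simp: prime_factors_product)
  also have "\<dots> = (\<Prod>p\<in>?P. kronecker_prime a p ^ multiplicity p m * kronecker_prime a p ^ multiplicity p n)"
    using assms
    by (intro prod.cong refl) (auto simp: prime_elem_multiplicity_mult_distrib power_add in_prime_factors_iff)
  also have "\<dots> = kronecker a m * kronecker a n"
    using assms by (simp add: prod.distrib *)
  finally show ?thesis .
qed

lemma kronecker_bound: "\<bar>kronecker a n\<bar> \<le> 1"
proof (cases "n = 0")
  case False
  have "\<bar>kronecker a n\<bar> = (\<Prod>p\<in>prime_factors n. \<bar>kronecker_prime a p\<bar> ^ multiplicity p n)"
    using False by (simp add: kronecker_def abs_prod power_abs)
  also have "\<dots> \<le> 1"
  proof (rule prod_le_1)
    fix p
    have "\<bar>kronecker_prime a p\<bar> \<le> 1" using kronecker_prime_cases[of a p] by auto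
    thus "0 \<le> \<bar>kronecker_prime a p\<bar> ^ multiplicity p n \<and> \<bar>kronecker_prime a p\<bar> ^ multiplicity p n \<le> 1"
      by (simp add: power_le_one)
  qed
  finally show ?thesis .
qed (simp add: kronecker_def)

section \<open>Euler products over a prescribed set of primes\<close>

definition prime_support_char :: "(nat \<Rightarrow> bool) \<Rightarrow> nat \<Rightarrow> int" where
  "prime_support_char Q n = (if \<forall>p\<in>prime_factors n. Q p then 1 else 0)"

lemma prime_support_char_prime: "prime p \<Longrightarrow> prime_support_char Q p = (if Q p then 1 else 0)"
  by (simp add: prime_support_char_def prime_factorization_prime)

interpretation kronecker: real_character "kronecker a" for a
  by standard (use kronecker_1 kronecker_mult kronecker_bound in auto)

interpretation prime_support: real_character "prime_support_char Q" for Q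
  by standard (auto simp: prime_support_char_def prime_factors_product)

interpretation trivial: real_character "\<lambda>_. 1"
  by standard auto

lemma zeta_eq_L_function: "zeta = L_function (\<lambda>_. 1)"
  by (simp add: zeta_def L_function_def fun_eq_iff)

text \<open>The partial products of \<open>prime_prod\<close> are the inverses of those in
  \<open>L_function_euler\<close>: a prime outside \<open>Q\<close> has coefficient 0, hence local
  factor 1.\<close>

lemma prime_prod_eq_L_function:
  assumes s: "Re s > 1"
  shows "prime_prod Q (\<lambda>p. inverse (1 - of_nat p powr (-s))) = L_function (prime_support_char Q) s"
proof -
  let ?g = "\<lambda>n. if prime n \<and> Q n then inverse (1 - of_nat n powr (-s)) else (1::complex)"
  have "(\<lambda>N. inverse (\<Prod>p | prime p \<and> p < N. 1 - of_int (prime_support_char Q p) * of_nat p powr (-s)))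
     \<longlonglongrightarrow> inverse (inverse (L_function (prime_support_char Q) s))"
    using prime_support.L_function_nonzero[OF s]
    by (intro tendsto_inverse prime_support.L_function_euler s) auto
  also have "(\<lambda>N. inverse (\<Prod>p | prime p \<and> p < N. 1 - of_int (prime_support_char Q p) * of_nat p powr (-s)))
     = (\<lambda>N. \<Prod>n<N. ?g n)"
  proof
    fix N
    have "(\<Prod>n<N. ?g n) = (\<Prod>p | prime p \<and> p < N. ?g p)"
      by (rule prod.mono_neutral_right) auto
    also have "\<dots> = (\<Prod>p | prime p \<and> p < N. inverse (1 - of_int (prime_support_char Q p) * of_nat p powr (-s)))"
      by (intro prod.cong refl) (auto simp: prime_support_char_prime)
    finally show "inverse (\<Prod>p | prime p \<and> p < N. 1 - of_int (prime_support_char Q p) * of_nat p powr (-s))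
      = (\<Prod>n<N. ?g n)" by (simp add: prod_inversef[symmetric] o_def)
  qed
  finally have "(\<lambda>N. \<Prod>n<N. ?g n) \<longlonglongrightarrow> L_function (prime_support_char Q) s" by simp
  \<comment> \<open>\<open>raw_has_prod\<close> multiplies over \<open>{..n}\<close>, hence the
    shift by one; it also demands a nonzero limit.\<close>
  hence "(\<lambda>N. \<Prod>n<Suc N. ?g n) \<longlonglongrightarrow> L_function (prime_support_char Q) s"
    by (rule LIMSEQ_Suc)
  hence "raw_has_prod ?g 0 (L_function (prime_support_char Q) s)"
    using prime_support.L_function_nonzero[OF s]
    by (simp add: raw_has_prod_def lessThan_Suc_atMost cong: if_cong)
  thus ?thesis
    unfolding prime_prod_def by (intro has_prod_unique[symmetric]) (auto simp: has_prod_def)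
qed

section \<open>Local factors and the functional equations\<close>

lemma norm_prime_powr_less_1:
  assumes "prime p" "Re s > 1"
  shows "norm (of_nat p powr (-s) :: complex) < 1"
proof -
  have "norm (of_nat p powr (-s) :: complex) = real p powr (- Re s)"
    by (simp add: norm_powr_real_powr)
  also have "\<dots> < 1" using assms prime_gt_1_nat[of p] by (simp add: powr_less_one)
  finally show ?thesis .
qed

lemma of_nat_powr_double: "of_nat p powr (-(2 * s)) = (of_nat p powr (-s :: complex))\<^sup>2"
  by (simp add: power2_eq_square flip: powr_add)

text \<open>The finite product is recast as an eventually constant sequence so that it can be
  compared with partial Euler products prime by prime. As \<open>a\<close> is nonzero, its prime
  divisors are bounded by its absolute value.\<close>

lemma prime_divisors_prod_tendsto:
  fixes h :: "nat \<Rightarrow> complex"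
  assumes "a \<noteq> 0"
  shows "(\<lambda>N. \<Prod>p | prime p \<and> p < N. if int p dvd a then h p else 1)
           \<longlonglongrightarrow> (\<Prod>p | prime p \<and> p dvd nat \<bar>a\<bar>. h p)"
proof (rule tendsto_eventually)
  have "(\<Prod>p | prime p \<and> p < N. if int p dvd a then h p else 1) = (\<Prod>p | prime p \<and> p dvd nat \<bar>a\<bar>. h p)"
    if N: "N > nat \<bar>a\<bar>" for N
  proof -
    have dvd: "p dvd nat \<bar>a\<bar> \<longleftrightarrow> int p dvd a" for p
      by (simp add: nat_dvd_iff int_dvd_int_iff[symmetric] del: int_dvd_int_iff)
    have "p < N" if "p dvd nat \<bar>a\<bar>" for p
      using dvd_imp_le[OF that] assms N by simp
    hence eq: "{p. prime p \<and> p dvd nat \<bar>a\<bar>} = {p \<in> {p. prime p \<and> p < N}. int p dvd a}"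
      by (auto simp: dvd)
    show ?thesis unfolding eq by (rule prod.inter_filter[symmetric]) simp
  qed
  thus "\<forall>\<^sub>F N in sequentially. (\<Prod>p | prime p \<and> p < N. if int p dvd a then h p else 1)
          = (\<Prod>p | prime p \<and> p dvd nat \<bar>a\<bar>. h p)"
    by (auto simp: eventually_at_top_dense)
qed

text \<open>Each equation is first cross-multiplied into an identity between inverses of Euler
  products. The partial products over \<open>p < N\<close> agree prime by prime, so their limits
  agree, and the nonvanishing of the series allows the division at the end.\<close>

lemma functional_equations:
  fixes a :: int
  defines "P e \<equiv> L_function (prime_support_char (\<lambda>p. kronecker a p = e))"
  assumes a: "a \<noteq> 0" and s: "Re s > 1"
  shows "P 1 (2 * s) / (P 1 s)\<^sup>2 = zeta (2 * s) / (zeta s * L_function (kronecker a) s) *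
           (\<Prod>p | prime p \<and> p dvd nat \<bar>a\<bar>. 1 + of_nat p powr (-s))"
    and "P (-1) (2 * s) / (P (-1) s)\<^sup>2 = L_function (kronecker a) s / zeta s *
           (\<Prod>p | prime p \<and> p dvd nat \<bar>a\<bar>. inverse (1 - of_nat p powr (-s)))"
proof -
  define x where "x = (\<lambda>p::nat. of_nat p powr (-s) :: complex)"
  define E where "E = (\<lambda>c N. \<Prod>p | prime p \<and> p < N. 1 - of_int (c p) * x p)"
  define E2 where "E2 = (\<lambda>c N. \<Prod>p | prime p \<and> p < N. 1 - of_int (c p) * (x p)\<^sup>2)"
  define D where "D = (\<lambda>h N. \<Prod>p | prime p \<and> p < N. if int p dvd a then h p else (1::complex))"
  have s2: "Re (2 * s) > 1" using s by simp
  have E: "E c \<longlonglongrightarrow> inverse (L_function c s)" and E2: "E2 c \<longlonglongrightarrow> inverse (L_function c (2 * s))"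
    if "real_character c" for c
    using real_character.L_function_euler[OF that s] real_character.L_function_euler[OF that s2]
    unfolding of_nat_powr_double E_def E2_def x_def by auto
  have D: "D h \<longlonglongrightarrow> (\<Prod>p | prime p \<and> p dvd nat \<bar>a\<bar>. h p)" for h
    unfolding D_def by (rule prime_divisors_prod_tendsto[OF a])
  note lims = E[OF kronecker.real_character_axioms] E[OF prime_support.real_character_axioms]
    E[OF trivial.real_character_axioms] E2[OF prime_support.real_character_axioms]
    E2[OF trivial.real_character_axioms] D
  note nz = prime_support.L_function_nonzero[OF s] prime_support.L_function_nonzero[OF s2]
    trivial.L_function_nonzero[OF s] trivial.L_function_nonzero[OF s2] kronecker.L_function_nonzero[OF s]
  have cases: "kronecker a p = 1 \<and> \<not> int p dvd a \<or> kronecker a p = -1 \<and> \<not> int p dvd a \<or>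
      kronecker a p = 0 \<and> int p dvd a" if "prime p" for p
    using kronecker_prime_cases[of a p] kronecker_prime_eq_0_iff[OF that, of a] kronecker_prime[OF that, of a]
    by auto
  let ?c = "\<lambda>e. prime_support_char (\<lambda>p. kronecker a p = e)"
  \<comment> \<open>With x for \<open>x p\<close>: if the symbol is 1, both local factors are
    (1-x)^2 (1-x^2). Otherwise both are 1-x^2 = (1-x)(1+x), where 1+x comes from the character for
    symbol -1 and from \<open>D\<close> for symbol 0.\<close>
  have eq: "(\<lambda>N. E (?c 1) N ^ 2 * E2 (\<lambda>_. 1) N) =
        (\<lambda>N. E2 (?c 1) N * E (kronecker a) N * E (\<lambda>_. 1) N * D (\<lambda>p. 1 + x p) N)"
    unfolding E_def E2_def D_def prod_power_distrib prod.distrib[symmetric]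
  proof (intro ext prod.cong refl)
    fix N p :: nat assume "p \<in> {p. prime p \<and> p < N}"
    hence p: "prime p" by simp
    from cases[OF p] show "(1 - of_int (?c 1 p) * x p)\<^sup>2 * (1 - of_int 1 * (x p)\<^sup>2) =
        (1 - of_int (?c 1 p) * (x p)\<^sup>2) * (1 - of_int (kronecker a p) * x p) * (1 - of_int 1 * x p) *
        (if int p dvd a then 1 + x p else 1)"
      by (elim disjE; elim conjE) (simp_all add: prime_support_char_prime[OF p] power2_eq_square algebra_simps)
  qed
  have l1: "(\<lambda>N. E (?c 1) N ^ 2 * E2 (\<lambda>_. 1) N) \<longlonglongrightarrow>
      inverse (P 1 s) ^ 2 * inverse (zeta (2 * s))"
    unfolding P_def zeta_eq_L_function by (intro tendsto_intros lims)
  have l2: "(\<lambda>N. E2 (?c 1) N * E (kronecker a) N * E (\<lambda>_. 1) N * D (\<lambda>p. 1 + x p) N) \<longlonglongrightarrow>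
      inverse (P 1 (2 * s)) * inverse (L_function (kronecker a) s) * inverse (zeta s) *
      (\<Prod>p | prime p \<and> p dvd nat \<bar>a\<bar>. 1 + x p)"
    unfolding P_def zeta_eq_L_function by (intro tendsto_intros lims)
  have "inverse (P 1 s) ^ 2 * inverse (zeta (2 * s)) =
      inverse (P 1 (2 * s)) * inverse (L_function (kronecker a) s) * inverse (zeta s) *
      (\<Prod>p | prime p \<and> p dvd nat \<bar>a\<bar>. 1 + x p)"
    by (rule LIMSEQ_unique[OF l1[unfolded eq] l2])
  thus "P 1 (2 * s) / (P 1 s)\<^sup>2 = zeta (2 * s) / (zeta s * L_function (kronecker a) s) *
           (\<Prod>p | prime p \<and> p dvd nat \<bar>a\<bar>. 1 + of_nat p powr (-s))"
    using nz unfolding P_def zeta_eq_L_function x_def by (simp add: field_simps)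
  have x1: "x p \<noteq> 1" if "prime p" for p
    using norm_prime_powr_less_1[OF that s] by (auto simp: x_def)
  \<comment> \<open>The local factors are 1-x for symbol 1 and (1-x)^2 (1+x) for symbol -1. For
    symbol 0, 1-x cancels against its inverse from \<open>D\<close>, which uses
    \<open>x1\<close>.\<close>
  have eq: "(\<lambda>N. E (?c (-1)) N ^ 2 * E (kronecker a) N) =
        (\<lambda>N. E2 (?c (-1)) N * E (\<lambda>_. 1) N * D (\<lambda>p. inverse (1 - x p)) N)"
    unfolding E_def E2_def D_def prod_power_distrib prod.distrib[symmetric]
  proof (intro ext prod.cong refl)
    fix N p :: nat assume "p \<in> {p. prime p \<and> p < N}"
    hence p: "prime p" by simp
    have inv: "x p * inverse (1 - x p) = inverse (1 - x p) - 1" using x1[OF p] by (simp add: field_simps)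
    from cases[OF p] show "(1 - of_int (?c (-1) p) * x p)\<^sup>2 * (1 - of_int (kronecker a p) * x p) =
        (1 - of_int (?c (-1) p) * (x p)\<^sup>2) * (1 - of_int 1 * x p) *
        (if int p dvd a then inverse (1 - x p) else 1)"
      by (elim disjE; elim conjE) (simp_all add: prime_support_char_prime[OF p] inv power2_eq_square algebra_simps)
  qed
  have l1: "(\<lambda>N. E (?c (-1)) N ^ 2 * E (kronecker a) N) \<longlonglongrightarrow>
      inverse (P (-1) s) ^ 2 * inverse (L_function (kronecker a) s)"
    unfolding P_def zeta_eq_L_function by (intro tendsto_intros lims)
  have l2: "(\<lambda>N. E2 (?c (-1)) N * E (\<lambda>_. 1) N * D (\<lambda>p. inverse (1 - x p)) N) \<longlonglongrightarrow>
      inverse (P (-1) (2 * s)) * inverse (zeta s) *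
      (\<Prod>p | prime p \<and> p dvd nat \<bar>a\<bar>. inverse (1 - x p))"
    unfolding P_def zeta_eq_L_function by (intro tendsto_intros lims)
  have "inverse (P (-1) s) ^ 2 * inverse (L_function (kronecker a) s) =
      inverse (P (-1) (2 * s)) * inverse (zeta s) *
      (\<Prod>p | prime p \<and> p dvd nat \<bar>a\<bar>. inverse (1 - x p))"
    by (rule LIMSEQ_unique[OF l1[unfolded eq] l2])
  thus "P (-1) (2 * s) / (P (-1) s)\<^sup>2 = L_function (kronecker a) s / zeta s *
           (\<Prod>p | prime p \<and> p dvd nat \<bar>a\<bar>. inverse (1 - of_nat p powr (-s)))"
    using nz unfolding P_def zeta_eq_L_function x_def by (simp add: field_simps)
qed

section \<open>The functions \<open>p1\<close> and \<open>p2\<close> as nonvanishing continuous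
  solutions\<close>

lemma satisfies_equation_iff:
  "satisfies_equation q p \<longleftrightarrow> (\<forall>s. Re s > 1 \<longrightarrow> p (2 * s) / (p s)\<^sup>2 = q s) \<and> Re_limit p 1"
  by (simp add: satisfies_equation_def half_plane_def)

text \<open>\<open>p1\<close> and \<open>p2\<close> are identified with Dirichlet series only for
  \<open>Re s > 1\<close>; raising the threshold to 2 stays in that range.\<close>

lemma Re_limit_cong:
  assumes "Re_limit f c" "\<And>s. Re s > 1 \<Longrightarrow> f s = g s"
  shows "Re_limit g c"
  unfolding Re_limit_def
proof (intro allI impI)
  fix e :: real assume "e > 0"
  with assms(1) obtain b where b: "b > 0" "\<And>s. Re s \<ge> b \<Longrightarrow> norm (f s - c) < e"
    unfolding Re_limit_def by metis
  have "norm (g s - c) < e" if "Re s \<ge> max b 2" for s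
    using b(2)[of s] assms(2)[of s] that by simp
  thus "\<exists>\<sigma>>0. \<forall>s. Re s \<ge> \<sigma> \<longrightarrow> norm (g s - c) < e"
    using b(1) by (intro exI[of _ "max b 2"]) auto
qed

lemma p1_eq_L_function:
  "Re s > 1 \<Longrightarrow> p1 K s = L_function (prime_support_char (\<lambda>p. kronecker (field_discriminant K) p = 1)) s"
  unfolding p1_def quadratic_character_def by (rule prime_prod_eq_L_function)

lemma p2_eq_L_function:
  "Re s > 1 \<Longrightarrow> p2 K s = L_function (prime_support_char (\<lambda>p. kronecker (field_discriminant K) p = -1)) s"
  unfolding p2_def quadratic_character_def by (rule prime_prod_eq_L_function)

lemma satisfies_equation_p1:
  assumes "field_discriminant K \<noteq> 0"
  shows "satisfies_equation (q1 K) (p1 K)"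
proof -
  have char: "quadratic_character K = kronecker (field_discriminant K)"
    by (simp add: quadratic_character_def fun_eq_iff)
  have "p1 K (2 * s) / (p1 K s)\<^sup>2 = q1 K s" if "Re s > 1" for s
    unfolding q1_def char using functional_equations(1)[OF assms that] that
    by (simp add: p1_eq_L_function)
  moreover have "Re_limit (p1 K) 1"
    by (rule Re_limit_cong[OF prime_support.Re_limit_L_function]) (simp add: p1_eq_L_function)
  ultimately show ?thesis by (simp add: satisfies_equation_iff)
qed

lemma satisfies_equation_p2:
  assumes "field_discriminant K \<noteq> 0"
  shows "satisfies_equation (q2 K) (p2 K)"
proof -
  have char: "quadratic_character K = kronecker (field_discriminant K)"
    by (simp add: quadratic_character_def fun_eq_iff)
  have "p2 K (2 * s) / (p2 K s)\<^sup>2 = q2 K s" if "Re s > 1" for s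
    unfolding q2_def char using functional_equations(2)[OF assms that] that
    by (simp add: p2_eq_L_function)
  moreover have "Re_limit (p2 K) 1"
    by (rule Re_limit_cong[OF prime_support.Re_limit_L_function]) (simp add: p2_eq_L_function)
  ultimately show ?thesis by (simp add: satisfies_equation_iff)
qed

lemma continuous_on_p1: "continuous_on half_plane (p1 K)"
  by (rule continuous_on_cong[THEN iffD2, OF refl _ prime_support.continuous_on_L_function])
     (simp add: p1_eq_L_function half_plane_def)

lemma continuous_on_p2: "continuous_on half_plane (p2 K)"
  by (rule continuous_on_cong[THEN iffD2, OF refl _ prime_support.continuous_on_L_function])
     (simp add: p2_eq_L_function half_plane_def)

lemma p1_nonzero: "s \<in> half_plane \<Longrightarrow> p1 K s \<noteq> 0"
  by (simp add: p1_eq_L_function prime_support.L_function_nonzero half_plane_def)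

lemma p2_nonzero: "s \<in> half_plane \<Longrightarrow> p2 K s \<noteq> 0"
  by (simp add: p2_eq_L_function prime_support.L_function_nonzero half_plane_def)

section \<open>Discriminants of quadratic fields\<close>

text \<open>Any irrational \<open>x\<close> in \<open>K\<close> satisfies a quadratic equation.
  Completing the square makes \<open>(x - b/2)^2\<close> a fraction \<open>p/q\<close>, and scaling
  by \<open>q\<close> turns it into the integer \<open>p * q\<close>.\<close>

lemma quadratic_field_generator:
  assumes K: "quadratic_field K"
  obtains w :: complex and m :: int
  where "w\<^sup>2 = of_int m" "w \<notin> \<rat>" "K = {of_rat x + of_rat y * w | x y. True}"
proof -
  interpret V: vector_space "\<lambda>(r::rat) (x::complex). of_rat r * x"
    by standard (auto simp: algebra_simps of_rat_add of_rat_mult)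
  have one: "1 \<in> K" and diff: "\<And>x y. x \<in> K \<Longrightarrow> y \<in> K \<Longrightarrow> x - y \<in> K"
    and mult: "\<And>x y. x \<in> K \<Longrightarrow> y \<in> K \<Longrightarrow> x * y \<in> K"
    and inv: "\<And>x. x \<in> K \<Longrightarrow> inverse x \<in> K" and dim: "V.dim K = 2"
    using K by (auto simp: quadratic_field_def)
  have zero: "0 \<in> K" using diff[OF one one] by simp
  have add: "x + y \<in> K" if "x \<in> K" "y \<in> K" for x y
    using diff[OF that(1) diff[OF zero that(2)]] by simp
  have nat: "of_nat n \<in> K" for n by (induction n) (use zero one add in auto)
  have int: "of_int k \<in> K" for k
    by (cases k) (use nat diff[OF zero nat] in \<open>auto simp del: of_nat_Suc simp flip: of_nat_Suc\<close>)
  have rat: "of_rat r \<in> K" for r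
    by (cases r) (use mult[OF int inv[OF int]] in \<open>auto simp: of_rat_rat divide_inverse\<close>)
  obtain B where B: "B \<subseteq> K" "V.independent B" "K \<subseteq> V.span B" "card B = 2"
    using V.basis_exists[of K] dim by metis
  have finB: "finite B" using B(4) by (intro card_ge_0_finite) auto
  have span1: "V.span {1} = range of_rat"
    by (auto simp: V.span_singleton)
  have "\<not> K \<subseteq> V.span {1}"
    using V.dim_le_card[of K "{1}"] dim by auto
  then obtain x where x: "x \<in> K" "x \<notin> V.span {1}" by blast
  have irrat: "x \<notin> \<rat>" using x(2) by (simp add: span1 Rats_def)
  have ind: "V.independent {x, 1}"
    using x(2) V.independent_insertI[of x "{1}"] by (simp add: V.dependent_single)
  \<comment> \<open>An element outside the span of \<open>x\<close> and 1 would give three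
    independent vectors in the span of the two-element basis \<open>B\<close>.\<close>
  have coord: "\<exists>c e. y = of_rat c + of_rat e * x" if "y \<in> K" for y
  proof -
    have "y \<in> V.span {x, 1}"
    proof (rule ccontr)
      assume y: "y \<notin> V.span {x, 1}"
      hence "V.independent (insert y {x, 1})" using V.independent_insertI[OF y ind] by simp
      moreover have "insert y {x, 1} \<subseteq> V.span B" using B(3) that x(1) one by auto
      ultimately have "card (insert y {x, 1}) \<le> card B"
        using V.independent_span_bound[OF finB] by blast
      moreover have "y \<noteq> x" "y \<noteq> 1" using y V.span_base[of _ "{x, 1}"] by auto
      moreover have "x \<noteq> 1" using irrat by auto
      ultimately show False using B(4) by simp
    qed
    then obtain e where "y - of_rat e * x \<in> range of_rat"
      by (auto simp: V.span_breakdown_eq[of y x] span1)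
    then obtain c where "y - of_rat e * x = of_rat c" by blast
    hence "y = of_rat c + of_rat e * x" by (simp add: algebra_simps)
    thus ?thesis by blast
  qed
  obtain a b where ab: "x\<^sup>2 = of_rat a + of_rat b * x"
    using coord[of "x\<^sup>2"] mult[OF x(1) x(1)] by (auto simp: power2_eq_square)
  obtain p q where pq: "q > 0" "a + b\<^sup>2 / 4 = Fract p q"
    by (cases "a + b\<^sup>2 / 4") auto
  define w where "w = of_int q * (x - of_rat (b / 2))"
  have q0: "complex_of_int q \<noteq> 0" using pq by simp
  have xw: "x = of_rat (b / 2) + of_rat (1 / of_int q) * w"
    using q0 by (simp add: w_def of_rat_divide)
  have "(x - of_rat (b / 2))\<^sup>2 = of_rat (a + b\<^sup>2 / 4)"
    using ab by (simp add: power2_eq_square algebra_simps of_rat_add of_rat_divide of_rat_mult)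
  also have "\<dots> = of_int p / of_int q"
    using pq by (simp add: of_rat_rat)
  finally have w2: "w\<^sup>2 = of_int (p * q)"
    using q0 by (simp add: w_def power_mult_distrib) (simp add: power2_eq_square)
  have wirrat: "w \<notin> \<rat>"
  proof
    assume "w \<in> \<rat>"
    hence "x \<in> \<rat>" by (subst xw) (intro Rats_add Rats_mult Rats_of_rat)
    with irrat show False ..
  qed
  have wK: "w \<in> K" unfolding w_def by (intro mult diff int x rat)
  have "K = {of_rat c + of_rat e * w | c e. True}"
  proof (intro equalityI subsetI)
    fix y assume "y \<in> K"
    then obtain c e where "y = of_rat c + of_rat e * x" using coord by blast
    hence "y = of_rat (c + e * (b / 2)) + of_rat (e * (1 / of_int q)) * w"
      by (subst (asm) xw) (simp only: of_rat_add of_rat_mult distrib_left add.assoc mult.assoc)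
    thus "y \<in> {of_rat c + of_rat e * w | c e. True}" by blast
  next
    fix y assume "y \<in> {of_rat c + of_rat e * w | c e. True}"
    thus "y \<in> K" using add mult rat wK by auto
  qed
  with w2 wirrat that show ?thesis by blast
qed

section \<open>Algebraic integers of degree at most two\<close>

lemma algebraic_int_quadratic:
  fixes z :: "'a :: field"
  assumes "z\<^sup>2 = of_int t * z - of_int n"
  shows "algebraic_int z"
proof (rule algebraic_int.intros[of "[:of_int n, - of_int t, 1:]"])
  show "poly [:of_int n, - of_int t, 1:] z = 0"
    using assms by (simp add: power2_eq_square algebra_simps)
qed (auto simp: coeff_pCons split: nat.splits)

text \<open>A rational algebraic integer is an integer.\<close>

lemma Ints_rat_quadratic:
  fixes u s p :: rat
  assumes "u\<^sup>2 = s * u - p" "s \<in> \<int>" "p \<in> \<int>"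
  shows "u \<in> \<int>"
proof -
  obtain t n where "s = of_int t" "p = of_int n" using assms(2,3) by (auto elim!: Ints_cases)
  hence "algebraic_int u" using assms(1) by (intro algebraic_int_quadratic[of _ t n]) simp
  moreover have "u \<in> \<rat>" by (cases u) (auto simp: Fract_of_int_quotient)
  ultimately show ?thesis using rational_algebraic_int_is_int by blast
qed

lemma Ints_rat_square: "(u::rat)\<^sup>2 \<in> \<int> \<Longrightarrow> u \<in> \<int>"
  by (rule Ints_rat_quadratic[of u 0 "- u\<^sup>2"]) auto

lemma poly_map_of_int_add:
  "poly (map_poly of_int (p + q)) z = poly (map_poly of_int p) z + poly (map_poly of_int q) (z :: 'a :: {comm_ring_1})"
  by (induction p q rule: poly_induct2) (simp_all add: map_poly_pCons algebra_simps)

lemma poly_map_of_int_smult: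
  "poly (map_poly of_int (Polynomial.smult k p)) z = of_int k * poly (map_poly of_int p) (z :: 'a :: {comm_ring_1})"
  by (induction p) (simp_all add: map_poly_pCons algebra_simps)

lemma poly_map_of_int_mult:
  "poly (map_poly of_int (p * q)) z = poly (map_poly of_int p) z * poly (map_poly of_int q) (z :: 'a :: {comm_ring_1})"
  by (induction p)
     (simp_all add: map_poly_pCons poly_map_of_int_add poly_map_of_int_smult algebra_simps)

text \<open>Gauss's lemma: comparing contents in k p = g h, where p is monic, shows that k divides the
  leading coefficient of h.\<close>

lemma algebraic_int_primitive_lead_coeff:
  fixes z :: complex and g :: "int poly"
  assumes "algebraic_int z" and irrat: "z \<notin> \<rat>"
    and g: "degree g = 2" "content g = 1" "poly (map_poly of_int g) z = 0"
  shows "lead_coeff g dvd 1"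
proof -
  obtain p where p: "poly (map_poly of_int p) z = 0" "lead_coeff p = 1"
    using assms(1) by (auto simp: algebraic_int_altdef_ipoly)
  have "g \<noteq> 0" using g(1) by auto
  \<comment> \<open>Pseudo-division keeps everything over the integers at the price of the factor
    \<open>k\<close>. The remainder is linear at most and vanishes at the irrational
    \<open>z\<close>, so it is 0.\<close>
  then obtain k h where k: "k \<noteq> 0" "Polynomial.smult k p = g * h + pseudo_mod p g"
    and deg: "degree (pseudo_mod p g) < 2"
    using pseudo_mod[of g p] g(1) by (metis degree_0 zero_less_numeral)
  define r where "r = pseudo_mod p g"
  have "poly (map_poly of_int (Polynomial.smult k p)) z = poly (map_poly of_int (g * h + r)) z"
    using k(2) by (simp add: r_def)
  hence "poly (map_poly of_int r) z = 0"
    using p(1) g(3) by (simp add: poly_map_of_int_add poly_map_of_int_mult poly_map_of_int_smult)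
  moreover obtain r0 r1 where r: "r = [:r0, r1:]"
  proof -
    have "r = [:poly.coeff r 0, poly.coeff r 1:]"
      using deg by (auto simp: r_def poly_eq_iff coeff_pCons coeff_eq_0 split: nat.splits)
    thus ?thesis using that by blast
  qed
  ultimately have *: "of_int r0 + z * of_int r1 = 0" by (simp add: map_poly_pCons)
  have "r1 = 0"
  proof (rule ccontr)
    assume "r1 \<noteq> 0"
    hence "z = - of_int r0 / of_int r1" using * by (simp add: field_simps add_eq_0_iff)
    with irrat show False by auto
  qed
  with * have "r = 0" by (simp add: r)
  hence kp: "Polynomial.smult k p = g * h" using k by (simp add: r_def)
  have "content p dvd lead_coeff p" by (rule content_dvd_coeff)
  hence "content p = 1" using p(2) is_unit_content_iff[of p] by metis
  hence "content h = \<bar>k\<bar>"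
    using arg_cong[OF kp, of content] g(2) by (simp add: content_mult)
  hence "k dvd lead_coeff h" using content_dvd_coeff[of h "degree h"] by simp
  then obtain l where l: "lead_coeff h = k * l" by blast
  have "k * 1 = lead_coeff (Polynomial.smult k p)" using p(2) k(1) by simp
  also have "\<dots> = k * (lead_coeff g * l)" by (simp only: kp lead_coeff_mult l mult.left_commute)
  finally have "k * 1 = k * (lead_coeff g * l)" .
  hence "1 = lead_coeff g * l" using k(1) by (subst (asm) mult_left_cancel) auto
  thus ?thesis by (rule dvdI)
qed

text \<open>For \<open>n = m\<close> the terms are half the traces of products of two elements, so
  this evaluates the determinant of the trace form up to the factor 4.\<close>

lemma brahmagupta_identity:
  fixes a b c d n :: "'a :: comm_ring_1"
  shows "(a * a + n * (b * b)) * (c * c + n * (d * d)) - (a * c + n * (b * d)) * (c * a + n * (d * b))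
           = n * (a * d - c * b)\<^sup>2"
  by (simp add: power2_eq_square algebra_simps)

section \<open>Coordinates with respect to 1 and w\<close>

text \<open>\<open>m\<close> may have square factors, so integrality is described below through
  trace and norm instead of a congruence for \<open>m\<close> modulo 4.\<close>

locale quadratic_generator =
  fixes K :: "complex set" and w :: complex and m :: int
  assumes square: "w\<^sup>2 = of_int m" and irrational: "w \<notin> \<rat>"
    and field_eq: "K = {of_rat x + of_rat y * w | x y. True}"
begin

definition elt :: "rat \<Rightarrow> rat \<Rightarrow> complex" where
  "elt x y = of_rat x + of_rat y * w"

lemma elt_in_K [simp]: "elt x y \<in> K"
  by (auto simp: elt_def field_eq)

lemma K_cases: "z \<in> K \<Longrightarrow> (\<And>x y. z = elt x y \<Longrightarrow> P) \<Longrightarrow> P"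
  by (auto simp: elt_def field_eq)

lemma w_square: "w * w = of_rat (of_int m)"
  using square by (simp add: power2_eq_square)

lemma m_nonzero: "m \<noteq> 0"
  using square irrational by auto

lemma elt_add: "elt x y + elt x' y' = elt (x + x') (y + y')"
  by (simp add: elt_def of_rat_add algebra_simps)

lemma elt_diff: "elt x y - elt x' y' = elt (x - x') (y - y')"
  by (simp add: elt_def of_rat_diff algebra_simps)

lemma elt_scale: "of_rat r * elt x y = elt (r * x) (r * y)"
  by (simp add: elt_def of_rat_mult algebra_simps)

lemma elt_mult: "elt x y * elt x' y' = elt (x * x' + of_int m * (y * y')) (x * y' + x' * y)"
proof -
  have "elt x y * elt x' y' = of_rat x * of_rat x' + of_rat y * of_rat y' * (w * w) +
      (of_rat x * of_rat y' + of_rat x' * of_rat y) * w"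
    by (simp add: elt_def algebra_simps)
  thus ?thesis unfolding w_square by (simp add: elt_def of_rat_add of_rat_mult algebra_simps)
qed

lemma elt_eq_iff [simp]: "elt x y = elt x' y' \<longleftrightarrow> x = x' \<and> y = y'"
proof
  assume eq: "elt x y = elt x' y'"
  have "y = y'"
  proof (rule ccontr)
    assume "y \<noteq> y'"
    hence ne: "of_rat (y - y') \<noteq> (0 :: complex)" by simp
    have "of_rat (y - y') * w = of_rat (x' - x)"
      using eq by (simp add: elt_def of_rat_diff algebra_simps)
    hence "w = of_rat (x' - x) / of_rat (y - y')" using ne by (simp add: field_simps)
    with irrational show False by (metis Rats_divide Rats_of_rat)
  qed
  with eq show "x = x' \<and> y = y'" by (simp add: elt_def)
qed auto

lemma elt_rat: "elt x 0 = of_rat x"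
  by (simp add: elt_def)

lemma elt_irrational: "y \<noteq> 0 \<Longrightarrow> elt x y \<notin> \<rat>"
  using elt_eq_iff[of x y _ 0] by (auto simp: elt_rat Rats_def simp del: elt_eq_iff)

text \<open>The element is a root of the monic polynomial with coefficients minus its trace and its
  norm. Clearing the denominators \<open>b\<close> and \<open>d\<close> gives \<open>P\<close>,
  whose primitive part has a unit as leading coefficient by Gauss's lemma.\<close>

lemma algebraic_int_eltD:
  assumes z: "algebraic_int (elt x y)" and y: "y \<noteq> 0"
  shows "2 * x \<in> \<int>" "x\<^sup>2 - of_int m * y\<^sup>2 \<in> \<int>"
proof -
  let ?n = "x\<^sup>2 - of_int m * y\<^sup>2"
  obtain a b where ab: "b > 0" "2 * x = of_int a / of_int b"
    by (cases "2 * x") (auto simp: Fract_of_int_quotient)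
  obtain c d where cd: "d > 0" "?n = of_int c / of_int d"
    by (cases ?n) (auto simp: Fract_of_int_quotient)
  define P where "P = [:b * c, - (a * d), b * d:]"
  define g where "g = primitive_part P"
  have degP: "degree P = 2" using ab cd by (simp add: P_def)
  hence P0: "P \<noteq> 0" by auto
  have P_eq: "Polynomial.smult (content P) g = P" by (simp add: g_def)
  have gdeg: "degree g = 2" by (simp add: g_def degP)
  have gcont: "content g = 1" by (simp add: g_def P0)
  have sq: "elt x y * elt x y = of_rat (2 * x) * elt x y - of_rat ?n"
    unfolding elt_rat[symmetric] elt_scale elt_diff elt_mult
    by (simp add: power2_eq_square algebra_simps)
  have Peval: "of_int (b * c) + elt x y * (of_int (b * d) * elt x y - of_int (a * d)) = 0"
  proof -
    have "of_rat (2 * x) = (of_int a / of_int b :: complex)" "of_rat ?n = (of_int c / of_int d :: complex)"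
      unfolding ab cd by (simp_all add: of_rat_divide)
    hence "elt x y * elt x y = of_int a / of_int b * elt x y - of_int c / of_int d" using sq by metis
    hence "of_int (b * d) * (elt x y * elt x y) = of_int (a * d) * elt x y - of_int (b * c)"
      using ab(1) cd(1) by (simp add: field_simps)
    thus ?thesis by (simp add: algebra_simps)
  qed
  have "poly (map_poly of_int P) (elt x y) = 0"
    using Peval by (simp add: P_def map_poly_pCons algebra_simps)
  hence "of_int (content P) * poly (map_poly of_int g) (elt x y) = 0"
    by (metis P_eq poly_map_of_int_smult)
  hence "poly (map_poly of_int g) (elt x y) = 0" using P0 by simp
  hence "lead_coeff g dvd 1"
    using algebraic_int_primitive_lead_coeff[OF z elt_irrational[OF y] gdeg gcont] by simp
  hence unit: "poly.coeff g 2 dvd 1" by (simp add: gdeg)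
  define k where "k = content P"
  have c2: "b * d = k * poly.coeff g 2" and c1: "- (a * d) = k * poly.coeff g 1" and c0: "b * c = k * poly.coeff g 0"
    using arg_cong[OF P_eq, of "\<lambda>p. poly.coeff p 2"] arg_cong[OF P_eq, of "\<lambda>p. poly.coeff p 1"]
      arg_cong[OF P_eq, of "\<lambda>p. poly.coeff p 0"]
    by (simp_all add: P_def k_def numeral_2_eq_2)
  \<comment> \<open>The leading coefficient \<open>b * d\<close> is the content up to a unit, so it
    divides the other coefficients \<open>- (a * d)\<close> and \<open>b * c\<close>; cancelling
    gives \<open>b dvd a\<close> and \<open>d dvd c\<close>.\<close>
  have "b * d dvd k" using unit c2 by (metis dvd_refl mult.right_neutral mult_dvd_mono is_unit_mult_iff dvd_mult_unit_iff mult_unit_dvd_iff)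
  hence "b * d dvd - (a * d)" "b * d dvd b * c" unfolding c1 c0 by (metis dvd_mult2)+
  hence "b dvd a" "d dvd c" using ab(1) cd(1) by auto
  thus "2 * x \<in> \<int>" "?n \<in> \<int>" using ab cd by (auto elim!: dvdE)
qed

section \<open>The ring of integers and an integral basis\<close>

text \<open>The two quantities are the trace and the norm of \<open>elt x y\<close>.\<close>

definition int_coords :: "rat \<Rightarrow> rat \<Rightarrow> bool" where
  "int_coords x y \<longleftrightarrow> 2 * x \<in> \<int> \<and> x\<^sup>2 - of_int m * y\<^sup>2 \<in> \<int>"

lemma int_coords_0: "int_coords x 0 \<longleftrightarrow> x \<in> \<int>"
  by (auto simp: int_coords_def dest: Ints_rat_square)

text \<open>Rational elements are treated apart, since the quadratic is not their minimal
  polynomial; for them both sides mean that \<open>x\<close> is an integer.\<close>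

lemma algebraic_int_elt_iff: "algebraic_int (elt x y) \<longleftrightarrow> int_coords x y"
proof (cases "y = 0")
  case True
  have "algebraic_int (of_rat x :: complex) \<longleftrightarrow> x \<in> \<int>"
  proof
    assume "algebraic_int (of_rat x :: complex)"
    hence "(of_rat x :: complex) \<in> \<int>" using rational_algebraic_int_is_int Rats_of_rat by metis
    then obtain k where "(of_rat x :: complex) = of_rat (of_int k)" by (auto elim!: Ints_cases)
    thus "x \<in> \<int>" by (simp del: of_rat_of_int_eq)
  next
    assume "x \<in> \<int>"
    then obtain k where "x = of_int k" by (auto elim!: Ints_cases)
    thus "algebraic_int (of_rat x :: complex)" by simp
  qed
  thus ?thesis using True by (simp add: elt_rat int_coords_0)
next
  case False
  show ?thesis
  proof
    assume "int_coords x y"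
    then obtain t n where tn: "2 * x = of_int t" "x\<^sup>2 - of_int m * y\<^sup>2 = of_int n"
      by (auto simp: int_coords_def elim!: Ints_cases)
    have "elt x y * elt x y = of_rat (2 * x) * elt x y - of_rat (x\<^sup>2 - of_int m * y\<^sup>2)"
      unfolding elt_rat[symmetric] elt_scale elt_diff elt_mult
      by (simp add: power2_eq_square algebra_simps)
    hence "(elt x y)\<^sup>2 = of_int t * elt x y - of_int n"
      unfolding tn by (simp add: power2_eq_square)
    thus "algebraic_int (elt x y)" by (rule algebraic_int_quadratic)
  next
    assume "algebraic_int (elt x y)"
    thus "int_coords x y" unfolding int_coords_def using algebraic_int_eltD False by blast
  qed
qed

lemma ring_of_integers_eq: "ring_of_integers K = {elt x y | x y. int_coords x y}"
proof (intro equalityI subsetI)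
  fix z assume "z \<in> ring_of_integers K"
  hence "z \<in> K" "algebraic_int z" by (auto simp: ring_of_integers_def)
  thus "z \<in> {elt x y | x y. int_coords x y}" by (elim K_cases) (simp add: algebraic_int_elt_iff)
next
  fix z assume "z \<in> {elt x y | x y. int_coords x y}"
  then obtain x y where "z = elt x y" "int_coords x y" by blast
  thus "z \<in> ring_of_integers K" by (simp add: ring_of_integers_def algebraic_int_elt_iff)
qed

text \<open>The norm of a difference involves the trace u of the product of one element with the
  conjugate of the other. It is an integer because it is rational and, together with its
  companion v, a root of a monic quadratic polynomial over the integers.\<close>

lemma int_coords_diff:
  assumes "int_coords x y" "int_coords x' y'"
  shows "int_coords (x - of_int k * x') (y - of_int k * y')"
proof -
  define n n' where "n = x\<^sup>2 - of_int m * y\<^sup>2" and "n' = x'\<^sup>2 - of_int m * y'\<^sup>2"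
  define u v where "u = 2 * x * x' - 2 * of_int m * y * y'" and "v = 2 * x * x' + 2 * of_int m * y * y'"
  have int: "2 * x \<in> \<int>" "2 * x' \<in> \<int>" "n \<in> \<int>" "n' \<in> \<int>"
    using assms by (auto simp: int_coords_def n_def n'_def)
  have "u + v = (2 * x) * (2 * x')" by (simp add: u_def v_def)
  hence 1: "u + v \<in> \<int>" using int(1,2) by (metis Ints_mult)
  \<comment> \<open>This combination of traces and norms equals \<open>u * v\<close>: the mixed
    terms cancel.\<close>
  have "n' * (2 * x)\<^sup>2 + n * (2 * x')\<^sup>2 - 4 * n * n' \<in> \<int>"
    by (intro Ints_add Ints_diff Ints_mult Ints_power Ints_numeral int)
  also have "n' * (2 * x)\<^sup>2 + n * (2 * x')\<^sup>2 - 4 * n * n' = u * v"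
    by (simp add: u_def v_def n_def n'_def power2_eq_square algebra_simps)
  finally have 2: "u * v \<in> \<int>" .
  have "u \<in> \<int>"
    by (rule Ints_rat_quadratic[OF _ 1 2]) (simp add: power2_eq_square algebra_simps)
  hence "n - of_int k * u + of_int k ^ 2 * n' \<in> \<int>" using int by simp
  also have "n - of_int k * u + of_int k ^ 2 * n' =
      (x - of_int k * x')\<^sup>2 - of_int m * (y - of_int k * y')\<^sup>2"
    by (simp add: u_def n_def n'_def power2_eq_square algebra_simps)
  finally show ?thesis
    using Ints_diff[OF int(1) Ints_mult[OF Ints_of_int[of k] int(2)]]
    by (simp add: int_coords_def algebra_simps)
qed

text \<open>Bounded denominators guarantee a least positive \<open>y\<close>. The square of
  \<open>2 * m * y\<close> is an integral combination of the squared trace and the norm.\<close>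

lemma int_coords_denominator:
  assumes "int_coords x y"
  shows "2 * of_int m * y \<in> \<int>"
proof (rule Ints_rat_square)
  have "of_int m * (2 * x)\<^sup>2 - 4 * of_int m * (x\<^sup>2 - of_int m * y\<^sup>2) \<in> \<int>"
    using assms unfolding int_coords_def
    by (elim conjE) (rule Ints_diff; rule Ints_mult; simp only: Ints_of_int Ints_power Ints_mult Ints_numeral)
  also have "of_int m * (2 * x)\<^sup>2 - 4 * of_int m * (x\<^sup>2 - of_int m * y\<^sup>2) = (2 * of_int m * y)\<^sup>2"
    by (simp add: power2_eq_square algebra_simps)
  finally show "(2 * of_int m * y)\<^sup>2 \<in> \<int>" .
qed

lemma ex_integral_basis:
  obtains x0 y0 where "int_coords x0 y0" "y0 > 0" "integral_basis K 1 (elt x0 y0)"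
proof -
  \<comment> \<open>On integral coordinates \<open>2 * m * y\<close> is an integer, so the floor
    loses nothing and minimizing \<open>M\<close> minimizes \<open>y > 0\<close>. The start
    \<open>(0, 1)\<close> is \<open>w\<close> itself.\<close>
  define M where "M = (\<lambda>p::rat \<times> rat. nat \<lfloor>\<bar>2 * of_int m * snd p\<bar>\<rfloor>)"
  have "int_coords 0 1" by (simp add: int_coords_def)
  then obtain p where p: "int_coords (fst p) (snd p) \<and> snd p > 0"
    and least: "\<And>q. int_coords (fst q) (snd q) \<and> snd q > 0 \<Longrightarrow> M p \<le> M q"
    using ex_has_least_nat[of "\<lambda>p. int_coords (fst p) (snd p) \<and> snd p > 0" "(0, 1)" M] by auto
  obtain x0 y0 where [simp]: "p = (x0, y0)" by force
  have b: "int_coords x0 y0" "y0 > 0" using p by auto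
  have min: "y0 \<le> y" if xy: "int_coords x y" "y > 0" for x y
  proof -
    obtain i j where ij: "2 * of_int m * y0 = of_int i" "2 * of_int m * y = of_int j"
      using int_coords_denominator[OF b(1)] int_coords_denominator[OF xy(1)] by (auto elim!: Ints_cases)
    have "M (x0, y0) \<le> M (x, y)" using least[of "(x, y)"] xy by simp
    hence "\<bar>i\<bar> \<le> \<bar>j\<bar>" unfolding M_def snd_conv ij by (simp flip: of_int_abs)
    hence "\<bar>2 * of_int m * y0\<bar> \<le> \<bar>2 * of_int m * y\<bar>" unfolding ij by linarith
    thus ?thesis using m_nonzero b(2) xy(2) by (simp add: abs_mult)
  qed
  have coords: "\<exists>j k. x = of_int j + of_int k * x0 \<and> y = of_int k * y0" if xy: "int_coords x y" for x y
  proof -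
    \<comment> \<open>Division with remainder by \<open>y0\<close>: the remainder lies in
      \<open>[0, y0)\<close> and again belongs to integral coordinates, so minimality makes it 0;
      what is left is a rational integer.\<close>
    define k where "k = \<lfloor>y / y0\<rfloor>"
    have ic: "int_coords (x - of_int k * x0) (y - of_int k * y0)"
      by (rule int_coords_diff[OF xy b(1)])
    have "of_int k \<le> y / y0" "y / y0 < of_int k + 1" by (auto simp: k_def) linarith
    hence "0 \<le> y - of_int k * y0" "y - of_int k * y0 < y0" using b(2) by (auto simp: field_simps)
    hence y: "y - of_int k * y0 = 0" using min[OF ic] by force
    hence "x - of_int k * x0 \<in> \<int>" using ic by (simp add: int_coords_0)
    then obtain j where "x - of_int k * x0 = of_int j" by (auto elim!: Ints_cases)
    with y show ?thesis by (intro exI[of _ j] exI[of _ k]) (simp add: algebra_simps)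
  qed
  have comb: "of_int j * 1 + of_int k * elt x0 y0 = elt (of_int j + of_int k * x0) (of_int k * y0)" for j k
    using elt_scale[of "of_int k" x0 y0] elt_add[of "of_int j" 0] by (simp add: elt_rat)
  have "bij_betw (\<lambda>(j, k). of_int j * 1 + of_int k * elt x0 y0) UNIV (ring_of_integers K)"
    unfolding comb
  proof (rule bij_betw_imageI)
    show "inj (\<lambda>(j, k). elt (of_int j + of_int k * x0) (of_int k * y0))"
      using b(2) by (auto simp: inj_on_def)
    have "int_coords (of_int j + of_int k * x0) (of_int k * y0)" for j k
      using int_coords_diff[of "of_int j" 0 x0 y0 "-k"] b(1) by (simp add: int_coords_0)
    thus "(\<lambda>(j, k). elt (of_int j + of_int k * x0) (of_int k * y0)) ` UNIV = ring_of_integers K"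
      using coords by (force simp: ring_of_integers_eq image_iff)
  qed
  hence "integral_basis K 1 (elt x0 y0)" by (simp add: integral_basis_def)
  with b that show ?thesis by blast
qed

section \<open>Embeddings, trace form and discriminant\<close>

text \<open>An embedding fixes the rationals and sends \<open>w\<close> to a square root of
  \<open>m\<close>, hence to \<open>w\<close> or \<open>- w\<close>.\<close>

lemma embedding_elt:
  assumes s: "s \<in> field_embeddings K"
  shows "(\<forall>x y. s (elt x y) = elt x y) \<or> (\<forall>x y. s (elt x y) = elt x (- y))"
proof -
  have one: "s 1 = 1" and add: "\<And>x y. x \<in> K \<Longrightarrow> y \<in> K \<Longrightarrow> s (x + y) = s x + s y"
    and mult: "\<And>x y. x \<in> K \<Longrightarrow> y \<in> K \<Longrightarrow> s (x * y) = s x * s y"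
    using s by (auto simp: field_embeddings_def)
  have rat_K: "of_rat x \<in> K" for x by (metis elt_rat elt_in_K)
  have int_K: "of_int k \<in> K" for k using rat_K[of "of_int k"] by simp
  have nat_K: "of_nat k \<in> K" for k using rat_K[of "of_nat k"] by simp
  have zero: "s 0 = 0" using add[of 0 0] int_K[of 0] by simp
  have nat: "s (of_nat n) = of_nat n" for n
  proof (induction n)
    case (Suc n)
    thus ?case using add[of 1 "of_nat n"] one nat_K[of 1] nat_K[of n] by simp
  qed (simp add: zero)
  have int: "s (of_int k) = of_int k" for k
  proof (cases k rule: int_cases2)
    case (nonpos n)
    have "s (of_int (-int n) + of_nat n) = s (of_int (-int n)) + s (of_nat n)" by (intro add int_K nat_K)
    hence "s (of_int (-int n)) = - of_nat n" using zero nat[of n] by (simp add: eq_neg_iff_add_eq_0)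
    thus ?thesis unfolding nonpos by simp
  qed (simp add: nat)
  have rat: "s (of_rat x) = of_rat x" for x
  proof -
    obtain a b where ab: "b > 0" "x = Fract a b" by (cases x)
    have xb: "of_rat x * of_int b = (of_int a :: complex)" using ab by (simp add: of_rat_rat)
    have "s (of_rat x) * of_int b = of_int a"
      using mult[OF rat_K[of x] int_K[of b]] by (simp only: xb int)
    with xb ab(1) show ?thesis
      by (metis mult_right_cancel of_int_eq_0_iff less_irrefl)
  qed
  have w: "w \<in> K" using elt_in_K[of 0 1] by (simp add: elt_def)
  have "s w * s w = w * w" using mult[OF w w] rat[of "of_int m"] by (simp only: w_square)
  hence "s w = w \<or> s w = - w" by (simp add: square_eq_iff)
  moreover have "s (elt x y) = of_rat x + of_rat y * s w" for x y
    using add[of "of_rat x" "of_rat y * w"] mult[OF rat_K w] rat rat_K elt_in_K[of 0 y]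
    by (simp add: elt_def)
  ultimately show ?thesis by (auto simp: elt_def of_rat_minus)
qed

lemma embeddingI:
  assumes "e = 1 \<or> e = (-1 :: rat)" "s \<in> extensional K" and s: "\<And>x y. s (elt x y) = elt x (e * y)"
  shows "s \<in> field_embeddings K"
proof -
  have "s 1 = 1" using s[of 1 0] by (simp add: elt_rat)
  moreover have "s (z + z') = s z + s z' \<and> s (z * z') = s z * s z'" if "z \<in> K" "z' \<in> K" for z z'
    using that assms(1)
    by (elim K_cases) (auto simp: elt_add elt_mult s algebra_simps simp del: mult_minus_left mult_minus_right)
  ultimately show ?thesis using assms(2) by (auto simp: field_embeddings_def PiE_def)
qed

lemma field_trace_elt: "field_trace K (elt x y) = of_rat (2 * x)"
proof -
  define re im where "re = (\<lambda>z. SOME a. \<exists>b. z = elt a b)" and "im = (\<lambda>z. SOME b. \<exists>a. z = elt a b)"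
  have re: "re (elt a b) = a" and im: "im (elt a b) = b" for a b
    by (auto simp: re_def im_def intro!: some_equality)
  \<comment> \<open>Sign 1 is the identity and sign -1 the conjugation. Restricting to
    \<open>K\<close> makes the maps extensional, as \<open>field_embeddings\<close> demands.\<close>
  define s where "s = (\<lambda>e. \<lambda>z\<in>K. elt (re z) (e * im z))"
  have s: "s e (elt a b) = elt a (e * b)" for e a b by (simp add: s_def re im)
  have "field_embeddings K = {s 1, s (-1)}"
  proof (intro equalityI subsetI)
    fix t assume t: "t \<in> field_embeddings K"
    hence ext: "t \<in> extensional K" by (auto simp: field_embeddings_def PiE_def)
    have eq: "t = s e" if "\<And>a b. t (elt a b) = elt a (e * b)" for e
      by (rule extensionalityI[OF ext]) (auto simp: s_def re im that elim!: K_cases)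
    from embedding_elt[OF t] show "t \<in> {s 1, s (-1)}"
      using eq[of 1] eq[of "-1"] by auto
  next
    fix t assume "t \<in> {s 1, s (-1)}"
    moreover have "s e \<in> extensional K" for e by (simp add: s_def)
    ultimately show "t \<in> field_embeddings K" using embeddingI[of _ _] s by blast
  qed
  \<comment> \<open>The trace sums over a set, so the two embeddings must be distinct; they differ
    at \<open>w\<close>.\<close>
  moreover have "s 1 \<noteq> s (-1)"
  proof
    assume "s 1 = s (-1)"
    hence "s 1 (elt 0 1) = s (-1) (elt 0 1)" by simp
    thus False by (simp add: s)
  qed
  ultimately have "field_trace K (elt x y) = elt x y + elt x (- y)"
    by (simp add: field_trace_def s)
  thus ?thesis by (simp add: elt_add elt_rat)
qed

lemma trace_form_det:
  "field_trace K (elt x y * elt x y) * field_trace K (elt x' y' * elt x' y')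
     - field_trace K (elt x y * elt x' y') * field_trace K (elt x' y' * elt x y)
   = of_rat (4 * of_int m * (x * y' - x' * y)\<^sup>2)"
proof -
  have "4 * of_int m * (x * y' - x' * y)\<^sup>2 =
      2 * (x * x + of_int m * (y * y)) * (2 * (x' * x' + of_int m * (y' * y')))
      - 2 * (x * x' + of_int m * (y * y')) * (2 * (x' * x + of_int m * (y' * y)))"
    using brahmagupta_identity[of x "of_int m" y x' y'] by (simp only: mult.commute mult.left_commute)
  thus ?thesis
    unfolding elt_mult field_trace_elt by (simp only: flip: of_rat_mult of_rat_diff)
qed

text \<open>Since 1 and \<open>w\<close> are integral, an integer matrix expresses them in the given
  basis. Its determinant times the one in question is the determinant of the identity.\<close>

lemma integral_basis_det:
  assumes "integral_basis K (elt x y) (elt x' y')"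
  shows "x * y' - x' * y \<noteq> 0"
proof -
  have "int_coords 1 0" "int_coords 0 1" by (simp_all add: int_coords_def)
  hence "elt 1 0 \<in> ring_of_integers K" "elt 0 1 \<in> ring_of_integers K"
    by (auto simp: ring_of_integers_eq)
  moreover have "ring_of_integers K = range (\<lambda>(j, k). of_int j * elt x y + of_int k * elt x' y')"
    using assms by (auto simp: integral_basis_def bij_betw_def)
  moreover have "of_int j * elt x y + of_int k * elt x' y' =
      elt (of_int j * x + of_int k * x') (of_int j * y + of_int k * y')" for j k
    using elt_scale[of "of_int j" x y] elt_scale[of "of_int k" x' y'] by (simp add: elt_add)
  ultimately obtain p q r s where
    pqrs: "elt 1 0 = elt (of_int p * x + of_int q * x') (of_int p * y + of_int q * y')"
    "elt 0 1 = elt (of_int r * x + of_int s * x') (of_int r * y + of_int s * y')"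
    by auto
  have "(of_int p * of_int s - of_int q * of_int r) * (x * y' - x' * y) =
      (of_int p * x + of_int q * x') * (of_int r * y + of_int s * y')
      - (of_int p * y + of_int q * y') * (of_int r * x + of_int s * x')"
    by (simp add: algebra_simps)
  also have "\<dots> = 1" using pqrs by (simp flip: of_int_mult)
  finally show ?thesis by auto
qed

text \<open>The explicit basis shows that the choice by \<open>SOME\<close> has a witness, namely
  \<open>t^2 - 4 * n\<close> for trace \<open>t\<close> and norm \<open>n\<close> of the second
  basis element. The chosen value may stem from another basis, but it is always \<open>4 * m\<close>
  times a nonzero square.\<close>

lemma discriminant_nonzero: "field_discriminant K \<noteq> 0"
proof -
  let ?disc = "\<lambda>D. \<exists>a b. integral_basis K a b \<and>
     of_int D = field_trace K (a * a) * field_trace K (b * b)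
                - field_trace K (a * b) * field_trace K (b * a)"
  obtain x0 y0 where b: "int_coords x0 y0" "integral_basis K 1 (elt x0 y0)"
    using ex_integral_basis by blast
  obtain t n where tn: "2 * x0 = of_int t" "x0\<^sup>2 - of_int m * y0\<^sup>2 = of_int n"
    using b(1) by (auto simp: int_coords_def elim!: Ints_cases)
  have "4 * of_int m * (1 * y0 - x0 * 0)\<^sup>2 = (2 * x0)\<^sup>2 - 4 * (x0\<^sup>2 - of_int m * y0\<^sup>2)"
    by (simp add: power2_eq_square algebra_simps)
  also have "\<dots> = of_int (t\<^sup>2 - 4 * n)" unfolding tn by simp
  finally have det: "4 * of_int m * (1 * y0 - x0 * 0)\<^sup>2 = (of_int (t\<^sup>2 - 4 * n) :: rat)" .
  have one: "elt 1 0 = 1" by (simp add: elt_rat)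
  have "?disc (t\<^sup>2 - 4 * n)"
    using trace_form_det[of 1 0 x0 y0] b(2) unfolding det one of_rat_of_int_eq by metis
  hence "?disc (field_discriminant K)"
    unfolding field_discriminant_def by (rule someI[of ?disc])
  then obtain a b where ab: "integral_basis K a b" and
    D: "of_int (field_discriminant K) = field_trace K (a * a) * field_trace K (b * b)
                - field_trace K (a * b) * field_trace K (b * a)" by blast
  have "(\<lambda>(j::int, k::int). of_int j * a + of_int k * b) ` UNIV \<subseteq> K"
    using ab by (auto simp: integral_basis_def bij_betw_def ring_of_integers_def)
  \<comment> \<open>Integer coordinates (1, 0) and (0, 1) show that the basis elements themselves
    lie in \<open>K\<close>.\<close>
  hence "of_int 1 * a + of_int 0 * b \<in> K" "of_int 0 * a + of_int 1 * b \<in> K" by blast+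
  then obtain x y x' y' where ab_eq: "a = elt x y" "b = elt x' y'" by (auto elim!: K_cases)
  have "of_int (field_discriminant K) = (of_rat (4 * of_int m * (x * y' - x' * y)\<^sup>2) :: complex)"
    using D trace_form_det by (simp only: ab_eq)
  moreover have "4 * of_int m * (x * y' - x' * y)\<^sup>2 \<noteq> 0"
    using integral_basis_det[of x y x' y'] ab m_nonzero by (simp add: ab_eq)
  ultimately show ?thesis by (metis of_int_0 of_rat_eq_0_iff)
qed

end

theorem theorem1:
  fixes K :: "complex set"
  assumes "quadratic_field K"
  shows "satisfies_equation (q1 K) (p1 K) \<and> satisfies_equation (q2 K) (p2 K) \<and>
     continuous_on half_plane (p1 K) \<and> continuous_on half_plane (p2 K) \<and>
     (\<forall>f. continuous_on half_plane f \<and> satisfies_equation (q1 K) f \<longrightarrow>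
        (\<forall>s\<in>half_plane. f s = p1 K s)) \<and>
     (\<forall>f. continuous_on half_plane f \<and> satisfies_equation (q2 K) f \<longrightarrow>
        (\<forall>s\<in>half_plane. f s = p2 K s))"
proof -
  obtain w m where "quadratic_generator K w m"
    using quadratic_field_generator[OF assms] unfolding quadratic_generator_def by metis
  hence D: "field_discriminant K \<noteq> 0"
    by (rule quadratic_generator.discriminant_nonzero)
  note eqs = satisfies_equation_p1[OF D] satisfies_equation_p2[OF D]
  show ?thesis
    using eqs continuous_on_p1 continuous_on_p2
      satisfies_equation_unique[OF eqs(1) continuous_on_p1 p1_nonzero]
      satisfies_equation_unique[OF eqs(2) continuous_on_p2 p2_nonzero]
    by blast
qed

end
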